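(* Let $n$ be an odd positive integer with $n\equiv 1\pmod 4$, let $q$ be an indeterminate, and for an integer $M\ge 0$ put $$S_M(q)=\sum_{k=0}^{M}[6k+1]\frac{(q;q^2)_k^3\,(q^{-1};q^4)_k}{(q^4;q^4)_k^3\,(q^{4};q^2)_k}\,q^{k^2+3k}\left(\sum_{i=1}^{k}\frac{q^{2i-1}}{[2i-1]^2}-\sum_{i=1}^{k}\frac{q^{4i}}{[4i]^2}\right).$$ Then, modulo $\Phi_n(q)^2$: (a) if $M=(3n+1)/4$ and $n>5$, then $S_M(q)\equiv 0$; (b) if $M=n-1$ and $n\ge 5$, then $S_M(q)\equiv -\dfrac{3q(1+q)[n]}{2}$.
   Context: For $a$ in the field $\mathbb{Q}(q)$ of rational functions, a base $Q$ (a power of $q$) and an integer $k\ge 0$, the $q$-shifted factorial is $(a;Q)_k=\prod_{j=0}^{k-1}(1-aQ^j)$, with $(a;Q)_0=1$. For a positive integer $m$, the $q$-integer is $[m]=[m]_q=\frac{1-q^m}{1-q}=1+q+\cdots+q^{m-1}$. $\Phi_n(q)=\prod_{1\le k\le n,\ \gcd(n,k)=1}(q-\zeta^k)$, with $\zeta$ a primitive $n$-th root of unity, is the $n$-th cyclotomic polynomial. Empty sums are $0$. For rational functions $A(q),B(q)\in\mathbb{Q}(q)$ and a polynomial $P(q)$, the congruence $A(q)\equiv B(q)\pmod{P(q)}$ means that, when $A(q)-B(q)$ is written in lowest terms as a quotient of polynomials in $\mathbb{Q}[q]$, its numerator is divisible by $P(q)$ (and hence its denominator is coprime to $P(q)$).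 *)

theory Defs
  imports Complex_Main "HOL-Computational_Algebra.Computational_Algebra"
begin

section \<open>The field of rational functions over the rationals\<close>

type_synonym ratfun = "rat poly fract"

definition q :: ratfun where
  "q = to_fract [:0, 1:]"

definition q_shifted_factorial :: "ratfun \<Rightarrow> ratfun \<Rightarrow> nat \<Rightarrow> ratfun" where
  "q_shifted_factorial a Q k = (\<Prod>j<k. 1 - a * Q ^ j)"

definition q_int :: "nat \<Rightarrow> ratfun" where
  "q_int m = (1 - q ^ m) / (1 - q)"

text \<open>\<open>P\<close> divides the numerator of \<open>A - B\<close> written in lowest terms; this does not depend on
  the representation, since \<open>a\<close> and \<open>b\<close> are unique up to a common nonzero constant.\<close>

definition ratfun_cong :: "ratfun \<Rightarrow> ratfun \<Rightarrow> rat poly \<Rightarrow> bool" where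
  "ratfun_cong A B P \<longleftrightarrow> (\<exists>a b. b \<noteq> 0 \<and> coprime a b \<and> A - B = Fract a b \<and> P dvd a)"

section \<open>Cyclotomic polynomials\<close>

definition complex_cyclotomic :: "nat \<Rightarrow> complex poly" where
  "complex_cyclotomic n = (\<Prod>k | 1 \<le> k \<and> k \<le> n \<and> coprime n k. [:- (cis (2 * pi / real n) ^ k), 1:])"

text \<open>The product above has rational coefficients; \<open>cyclotomic n\<close> is the same polynomial,
  regarded as an element of the ring of rational polynomials. Lemma \<open>of_rat_cyclotomic\<close>
  below shows that the definite description is well-defined.\<close>

definition cyclotomic :: "nat \<Rightarrow> rat poly" where
  "cyclotomic n = (THE p. map_poly of_rat p = complex_cyclotomic n)"

lemma of_rat_poly_mult:
  "map_poly of_rat (p * r) = (map_poly of_rat p * map_poly of_rat r :: complex poly)"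
  by (rule poly_eqI) (simp add: coeff_map_poly coeff_mult of_rat_sum of_rat_mult)

lemma of_rat_poly_add:
  "map_poly of_rat (p + r) = (map_poly of_rat p + map_poly of_rat r :: complex poly)"
  by (rule poly_eqI) (simp add: coeff_map_poly of_rat_add)

lemma of_rat_poly_inj:
  "map_poly of_rat p = (map_poly of_rat r :: complex poly) \<Longrightarrow> p = r"
  by (metis (no_types, lifting) coeff_map_poly of_rat_0 of_rat_eq_iff poly_eqI)

lemma of_rat_poly_degree: "degree (map_poly of_rat p :: complex poly) = degree p"
  by (rule degree_map_poly) simp

lemma of_rat_poly_quotient:
  fixes c :: "complex poly"
  assumes "map_poly of_rat b * c = map_poly of_rat a" "b \<noteq> 0"
  shows "\<exists>s. map_poly of_rat s = c"
proof -
  let ?h = "map_poly of_rat :: rat poly \<Rightarrow> complex poly"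
  have h: "?h a = ?h b * ?h (a div b) + ?h (a mod b)"
    by (metis mult_div_mod_eq of_rat_poly_add of_rat_poly_mult)
  then have dvd: "?h b * (c - ?h (a div b)) = ?h (a mod b)"
    using assms(1) by (simp add: algebra_simps)
  have nz: "?h b \<noteq> 0"
    using assms(2) of_rat_poly_inj[of b 0] by auto
  have "c - ?h (a div b) = 0"
  proof (rule ccontr)
    assume n0: "c - ?h (a div b) \<noteq> 0"
    then have "degree (?h (a mod b)) = degree (?h b) + degree (c - ?h (a div b))"
      using nz by (simp add: degree_mult_eq flip: dvd)
    then have "degree (a mod b) \<ge> degree b"
      by (simp add: of_rat_poly_degree)
    moreover have "a mod b \<noteq> 0"
      using dvd n0 nz by auto
    ultimately show False
      using degree_mod_less[OF assms(2), of a] by simp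
  qed
  then show ?thesis by (metis eq_iff_diff_eq_0)
qed

lemma complex_cyclotomic_nonzero: "complex_cyclotomic n \<noteq> 0"
  unfolding complex_cyclotomic_def by (subst prod_zero_iff) auto

lemma prod_roots_of_unity:
  assumes "n > 0"
  shows "(\<Prod>k=1..n. [:- (cis (2 * pi / real n) ^ k), 1:]) = monom 1 n - 1"
proof -
  let ?z = "\<lambda>k. cis (2 * pi / real n) ^ k"
  let ?p = "\<Prod>k=1..n. [:- ?z k, 1:]"
  have z: "?z k = cis (2 * pi * real k / real n)" for k
    by (simp add: DeMoivre mult.commute)
  have bij: "bij_betw ?z {..<n} {z. z ^ n = 1}"
    using bij_betw_roots_unity[OF assms] unfolding z .
  have zn: "?z n = ?z 0"
    using assms by (simp add: z cis_2pi)
  have im: "?z ` {1..n} = ?z ` {..<n}"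
  proof -
    have "?z k \<in> ?z ` {..<n}" if "k \<in> {1..n}" for k
      using that zn assms by (cases "k = n") (auto intro: image_eqI[of _ _ 0])
    moreover have "?z k \<in> ?z ` {1..n}" if "k \<in> {..<n}" for k
      using that zn assms by (cases "k = 0") (auto intro: image_eqI[of _ _ n])
    ultimately show ?thesis by blast
  qed
  have inj: "inj_on ?z {1..n}"
    using bij im bij_betw_same_card[OF bij] by (intro eq_card_imp_inj_on) (simp_all add: bij_betw_def)
  have monic: "lead_coeff ?p = 1"
    by (simp add: lead_coeff_prod)
  have degp: "degree ?p = n"
    by (subst degree_prod_eq_sum_degree) auto
  have degm: "degree (monom 1 n - 1 :: complex poly) \<le> n"
    by (intro degree_diff_le) (simp_all add: degree_monom_le)
  show ?thesis
  proof (rule ccontr)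
    assume ne: "?p \<noteq> monom 1 n - 1"
    let ?d = "?p - (monom 1 n - 1)"
    have d0: "?d \<noteq> 0" using ne by simp
    have "coeff ?d n = 0"
      using monic degp assms by simp
    moreover have "degree ?d \<le> n"
      by (rule degree_diff_le[OF eq_refl[OF degp] degm])
    ultimately have "degree ?d < n"
      using d0 by (metis le_neq_implies_less leading_coeff_0_iff)
    moreover have "{z. z ^ n = 1} \<subseteq> {z. poly ?d z = 0}"
    proof
      fix z :: complex assume "z \<in> {z. z ^ n = 1}"
      then have z1: "z ^ n = 1" by simp
      then obtain k where "k \<in> {1..n}" "z = ?z k"
        using bij im unfolding bij_betw_def by blast
      then have "poly ?p z = 0"
        unfolding poly_prod by (intro prod_zero) auto
      then show "z \<in> {z. poly ?d z = 0}"
        using z1 by (simp add: poly_monom)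
    qed
    then have "n \<le> card {z. poly ?d z = 0}"
      using card_roots_unity_eq[OF assms] card_mono[OF poly_roots_finite[OF d0]] by metis
    ultimately show False
      using card_poly_roots_bound[OF d0] by linarith
  qed
qed

lemma prod_complex_cyclotomic:
  assumes "n > 0"
  shows "(\<Prod>d | d dvd n. complex_cyclotomic d) = monom 1 n - 1"
proof -
  let ?f = "\<lambda>k. [:- (cis (2 * pi / real n) ^ k), 1:]"
  have "(\<Prod>k=1..n. ?f k) = (\<Prod>d | d dvd n. \<Prod>k | k \<in> {1..n} \<and> n div gcd n k = d. ?f k)"
    by (rule prod.group[symmetric]) (use assms in \<open>auto simp: div_dvd_iff_mult\<close>)
  also have "\<dots> = (\<Prod>d | d dvd n. complex_cyclotomic d)"
  proof (rule prod.cong)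
    fix d assume "d \<in> {d. d dvd n}"
    then obtain e where e: "n = d * e" by auto
    with assms have pos: "d > 0" "e > 0" by auto
    show "(\<Prod>k | k \<in> {1..n} \<and> n div gcd n k = d. ?f k) = complex_cyclotomic d"
      unfolding complex_cyclotomic_def
    proof (rule prod.reindex_bij_witness[of _ "\<lambda>j. j * e" "\<lambda>k. k div e"])
      fix k assume k: "k \<in> {k. k \<in> {1..n} \<and> n div gcd n k = d}"
      then have "n div gcd n k * gcd n k = n" and "n div gcd n k = d"
        by auto
      then have "n = d * gcd n k" by simp
      then have g: "gcd n k = e" using e pos by auto
      then obtain j where j: "k = j * e" by (metis dvdE gcd_dvd2 mult.commute)
      show "k div e * e = k" using j pos by simp
      have cop: "coprime d j"
        using g pos unfolding e j by (simp add: gcd_mult_right coprime_iff_gcd_eq_1 gcd.commute)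
      show "k div e \<in> {k. 1 \<le> k \<and> k \<le> d \<and> coprime d k}"
        using k cop pos by (auto simp: e j Suc_le_eq)
      have "cis (2 * pi / real n) ^ k = cis (2 * pi / real d) ^ j"
        using pos by (simp add: DeMoivre e j field_simps)
      then show "[:- (cis (2 * pi / real d) ^ (k div e)), 1:] = ?f k"
        using j pos by simp
    next
      fix j assume j: "j \<in> {k. 1 \<le> k \<and> k \<le> d \<and> coprime d k}"
      show "j * e div e = j" using pos by simp
      have "gcd n (j * e) = e"
        using j gcd_mult_distrib_nat[of e d j] by (simp add: e coprime_iff_gcd_eq_1 mult.commute)
      then show "j * e \<in> {k. k \<in> {1..n} \<and> n div gcd n k = d}"
        using j pos by (auto simp: e Suc_le_eq)
    qed
  qed simp
  finally show ?thesis
    using prod_roots_of_unity[OF assms] by simp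
qed

lemma complex_cyclotomic_rational: "\<exists>p. map_poly of_rat p = complex_cyclotomic n"
proof (induction n rule: less_induct)
  case (less n)
  let ?h = "map_poly of_rat :: rat poly \<Rightarrow> complex poly"
  show ?case
  proof (cases "n = 0")
    case True
    then have "{k. 1 \<le> k \<and> k \<le> n \<and> coprime n k} = {}" by auto
    then have "?h 1 = complex_cyclotomic n"
      unfolding complex_cyclotomic_def by (simp only: prod.empty) simp
    then show ?thesis ..
  next
    case False
    obtain r where r: "\<And>d. d < n \<Longrightarrow> ?h (r d) = complex_cyclotomic d"
      using less.IH by metis
    let ?D = "{d. d dvd n \<and> d < n}"
    have hprod: "?h (\<Prod>d\<in>A. r d) = (\<Prod>d\<in>A. ?h (r d))" for A
      by (induction A rule: infinite_finite_induct) (simp_all add: of_rat_poly_mult)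
    have R: "?h (\<Prod>d\<in>?D. r d) = (\<Prod>d\<in>?D. complex_cyclotomic d)"
      unfolding hprod by (rule prod.cong) (auto simp: r)
    have "{d. d dvd n} = insert n ?D"
      using False by (auto dest: dvd_imp_le simp: order_le_less)
    then have "(\<Prod>d | d dvd n. complex_cyclotomic d) = ?h (\<Prod>d\<in>?D. r d) * complex_cyclotomic n"
      by (simp add: R mult.commute)
    moreover have "?h (monom 1 n - 1) = monom 1 n - 1"
      by (rule poly_eqI) (simp add: coeff_map_poly of_rat_diff coeff_monom)
    ultimately have eq: "?h (\<Prod>d\<in>?D. r d) * complex_cyclotomic n = ?h (monom 1 n - 1)"
      using prod_complex_cyclotomic False by simp
    have "?h (\<Prod>d\<in>?D. r d) \<noteq> 0"
      unfolding R by (subst prod_zero_iff) (auto simp: complex_cyclotomic_nonzero)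
    then have "(\<Prod>d\<in>?D. r d) \<noteq> 0"
      by (metis map_poly_0)
    from of_rat_poly_quotient[OF eq this] show ?thesis .
  qed
qed

lemma of_rat_cyclotomic: "map_poly of_rat (cyclotomic n) = complex_cyclotomic n"
proof -
  have "\<exists>!p. map_poly of_rat p = complex_cyclotomic n"
    using complex_cyclotomic_rational[of n] of_rat_poly_inj by metis
  then show ?thesis
    unfolding cyclotomic_def by (rule theI')
qed

section \<open>The truncated sum\<close>

definition S :: "nat \<Rightarrow> ratfun" where
  "S M = (\<Sum>k=0..M.
     q_int (6 * k + 1)
     * (q_shifted_factorial q (q ^ 2) k ^ 3 * q_shifted_factorial (inverse q) (q ^ 4) k)
     / (q_shifted_factorial (q ^ 4) (q ^ 4) k ^ 3 * q_shifted_factorial (q ^ 4) (q ^ 2) k)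
     * q ^ (k ^ 2 + 3 * k)
     * ((\<Sum>i=1..k. q ^ (2 * i - 1) / q_int (2 * i - 1) ^ 2)
        - (\<Sum>i=1..k. q ^ (4 * i) / q_int (4 * i) ^ 2)))"

end

theory Submission
  imports Defs "HOL-Computational_Algebra.Field_as_Ring"
begin

text \<open>The differences of sums inside \<^term>\<open>S M\<close> are a derivative. Put \<open>u = a + 1/a - 2\<close>. Then
\<open>(1 - a y) (1 - y/a) = (1 - y)\<^sup>2 - y u\<close>, so that replacing \<open>(q;q\<^sup>2)\<^sub>k\<^sup>2\<close> by \<open>(aq, q/a; q\<^sup>2)\<^sub>k\<close> and
\<open>(q\<^sup>4;q\<^sup>4)\<^sub>k\<^sup>2\<close> by \<open>(aq\<^sup>4, q\<^sup>4/a; q\<^sup>4)\<^sub>k\<close> turns the summand without its last factor into a function of \<open>u\<close>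
whose coefficient of \<open>u\<close> is, up to a constant factor, the summand of \<^term>\<open>S M\<close>. Write \<open>F(u)\<close>
for the deformed sum. It is a value of a quadratic hypergeometric sum of Gasper and Rahman, with base
\<open>p = q\<^sup>2\<close>, well-poised parameter \<open>A = q\<close>, and a last parameter whose inverse \<open>e\<close> is \<open>q\<close>.

This sum has a closed product form when \<open>e = p\<^sup>2\<^sup>m\<close> (lemma \<open>quad_sum_closed_form\<close>); the proof is a first-order
recurrence under \<open>e \<rightarrow> e p\<^sup>2\<close>, which telescopes in the truncation length (lemma \<open>cleared_sum_step\<close>). The
value \<open>e = q\<close> is not of this kind, but \<open>e = q\<^bsup>1+3n\<^esup>\<close> is, and \<open>q\<^sup>n\<close> is congruent to \<open>1\<close>
modulo \<open>\<Phi>\<^sub>n(q)\<close>. To compare the two values modulo \<open>\<Phi>\<^sub>n(q)\<^sup>2\<close>, let \<open>A = q\<^bsup>1-rn\<^esup>\<close> and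
\<open>e = q\<^bsup>1+sn\<^esup>\<close>. Modulo \<open>(1 - q\<^sup>n)\<^sup>2\<close> every sum of quotients of such powers is an affine function of
\<open>(r, s)\<close>: a first-order Taylor expansion. For \<open>r = 1\<close> and \<open>s = 3, 7\<close> the closed form contains the factor
\<open>1 - A p\<^bsup>(n-1)/2\<^esup> = 0\<close>, so the slope in the direction \<open>s\<close> vanishes and the values at
\<open>(0, 0)\<close> and \<open>(0, 3)\<close> agree modulo \<open>(1 - q\<^sup>n)\<^sup>2\<close> (lemma \<open>perturbed_sum_cong\<close>). The closed form at \<open>(0, 3)\<close>
contains \<open>(1 - q\<^sup>n) (1 - q\<^bsup>3n\<^esup>)\<close>, hence vanishes (lemma \<open>quad_sum_cong_0\<close>).

All this holds in a ring of first-order jets in \<open>u\<close> whose coefficients have denominators prime to \<open>\<Phi>\<^sub>n(q)\<close>, as long as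
the sum stops at \<open>k = n - 2\<close>. The terms with \<open>(3n+1)/4 < k \<le> n - 2\<close> vanish individually modulo \<open>\<Phi>\<^sub>n(q)\<^sup>2\<close>, which leaves the term with
\<open>k = n - 1\<close>; its denominator contains \<open>1 - q\<^sup>2\<^sup>n\<close>, so that it is divisible by \<open>\<Phi>\<^sub>n(q)\<close> only once. Its value
follows from the fact that the products of \<open>1 - q\<^sup>i\<close> over any complete set of nonzero residues \<open>i\<close> modulo \<open>n\<close> agree
modulo \<open>\<Phi>\<^sub>n(q)\<close> (lemma \<open>boundary_value\<close>). For \<open>n = 5\<close> the numbers \<open>(3n+1)/4\<close> and
\<open>n - 1\<close> coincide, and the closed form at \<open>(0, 3)\<close> then includes a term \<open>k = n - 1\<close> of its own, which has to be subtracted;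
the factor \<open>5/2 - 5/5\<close> that results is the \<open>3/2\<close> of the other cases.\<close>

unbundle fps_syntax

section \<open>A terminating quadratic summation formula\<close>

text \<open>With \<open>c = b + p/b\<close>, the factor \<open>quad_num\<close> is \<open>(1 - b p\<^sup>j) (1 - p\<^bsup>j+1\<^esup>/b)\<close> and \<open>quad_den\<close> is
\<open>(1 - A p\<^bsup>2j+2\<^esup>/b) (1 - A b p\<^bsup>2j+1\<^esup>)\<close>. Only the symmetric combination \<open>c\<close> enters, so the formula
makes sense for an arbitrary \<open>c\<close>, and below \<open>c\<close> carries the variable of the jets.\<close>

definition quad_num :: "'a::field \<Rightarrow> 'a \<Rightarrow> nat \<Rightarrow> 'a" where
  "quad_num p c j = 1 - p ^ j * c + p ^ (2 * j + 1)"

definition quad_den :: "'a::field \<Rightarrow> 'a \<Rightarrow> 'a \<Rightarrow> nat \<Rightarrow> 'a" where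
  "quad_den p A c j = 1 - A * p ^ (2 * j + 1) * c + A\<^sup>2 * p ^ (4 * j + 3)"

definition quad_coeff :: "'a::field \<Rightarrow> 'a \<Rightarrow> 'a \<Rightarrow> nat \<Rightarrow> 'a" where
  "quad_coeff p A c k = (\<Prod>j<k. A * p ^ (j + 1) * (1 - A * p ^ j) * quad_num p c j
     / ((1 - p ^ (2 * j + 2)) * quad_den p A c j))"

text \<open>The inverse \<open>e\<close> of the usual last parameter \<open>d\<close> is used because \<open>(d;p\<^sup>2)\<^sub>k d\<^sup>-\<^sup>k\<close> then becomes the
polynomial \<open>\<Prod>j<k. e - p\<^sup>2\<^sup>j\<close>, which makes the termination at \<open>e = p\<^sup>2\<^sup>m\<close> visible.\<close>

definition quad_sum :: "'a::field \<Rightarrow> 'a \<Rightarrow> 'a \<Rightarrow> 'a \<Rightarrow> nat \<Rightarrow> 'a" where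
  "quad_sum p A c e K = (\<Sum>k\<le>K. (1 - A * p ^ (3 * k)) * quad_coeff p A c k
     * (\<Prod>j<k. (e - p ^ (2 * j)) / (1 - A * p ^ (j + 1) * e)))"

text \<open>This is \<^term>\<open>quad_sum p A c e K\<close> multiplied by its denominators \<open>1 - A p\<^sup>j\<^sup>+\<^sup>1 e\<close>. Without them the recurrence in \<open>e\<close>
can be started at \<open>e = 1\<close> even if \<open>A p\<^sup>h = 1\<close> for some \<open>h\<close>, which is the case that makes the sum vanish.\<close>

primrec cleared_sum :: "'a::field \<Rightarrow> 'a \<Rightarrow> 'a \<Rightarrow> 'a \<Rightarrow> nat \<Rightarrow> 'a" where
  "cleared_sum p A c e 0 = 1 - A"
| "cleared_sum p A c e (Suc K) = (1 - A * p ^ (K + 1) * e) * cleared_sum p A c e K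
     + (1 - A * p ^ (3 * Suc K)) * quad_coeff p A c (Suc K) * (\<Prod>j<Suc K. e - p ^ (2 * j))"

lemma cleared_sum_eq:
  assumes "\<And>j. j < K \<Longrightarrow> 1 - A * p ^ (j + 1) * e \<noteq> 0"
  shows "cleared_sum p A c e K = (\<Prod>j<K. 1 - A * p ^ (j + 1) * e) * quad_sum p A c e K"
  using assms
proof (induction K)
  case 0
  then show ?case by (simp add: quad_sum_def quad_coeff_def)
next
  case (Suc K)
  have nz: "(\<Prod>j<Suc K. 1 - A * p ^ (j + 1) * e) \<noteq> 0"
    using Suc.prems by (subst prod_zero_iff) auto
  have "quad_sum p A c e (Suc K) = quad_sum p A c e K + (1 - A * p ^ (3 * Suc K)) *
      quad_coeff p A c (Suc K) * ((\<Prod>j<Suc K. e - p ^ (2 * j)) / (\<Prod>j<Suc K. 1 - A * p ^ (j + 1) * e))"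
    by (simp add: quad_sum_def prod_dividef del: prod.lessThan_Suc)
  then have "(\<Prod>j<Suc K. 1 - A * p ^ (j + 1) * e) * quad_sum p A c e (Suc K) =
      (1 - A * p ^ (K + 1) * e) * ((\<Prod>j<K. 1 - A * p ^ (j + 1) * e) * quad_sum p A c e K)
      + (1 - A * p ^ (3 * Suc K)) * quad_coeff p A c (Suc K) * (\<Prod>j<Suc K. e - p ^ (2 * j))"
    using nz by (simp add: distrib_left mult_ac)
  then show ?case
    using Suc by simp
qed

lemma prod_shift_argument: 
  fixes e p :: "'a::field"
  shows "(\<Prod>j<Suc K. e * p\<^sup>2 - p ^ (2 * j)) = (e * p\<^sup>2 - 1) * p ^ (2 * K) * (\<Prod>j<K. e - p ^ (2 * j))"
proof -
  have "(\<Prod>j<Suc K. e * p\<^sup>2 - p ^ (2 * j)) = (e * p\<^sup>2 - 1) * (\<Prod>j<K. p\<^sup>2 * (e - p ^ (2 * j)))"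
    by (subst prod.lessThan_Suc_shift) (simp add: algebra_simps power2_eq_square)
  then show ?thesis by (simp add: prod.distrib power_mult)
qed

text \<open>Both sums on the left satisfy a recurrence in \<open>K\<close>, and their combination telescopes: the right-hand side is the
certificate of a \<open>q\<close>-analogue of the Wilf-Zeilberger method. It vanishes at \<open>e = p\<^sup>2\<^sup>m\<close> with \<open>m < K\<close>.\<close>

lemma cleared_sum_step:
  assumes nz: "\<And>j. j < K \<Longrightarrow> 1 - p ^ (2 * j + 2) \<noteq> 0" "\<And>j. j < K \<Longrightarrow> quad_den p A c j \<noteq> 0"
  shows "(1 - A * p * e * c + A\<^sup>2 * p ^ 3 * e\<^sup>2) * cleared_sum p A c (e * p\<^sup>2) K
       - (1 - A * p ^ (K + 1) * e) * (1 - A * p ^ (K + 2) * e) * cleared_sum p A c e K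
     = e * (A * p ^ (K + 1) * (1 - A * p ^ K) * quad_num p c K) * quad_coeff p A c K * (\<Prod>j<K. e - p ^ (2 * j))"
  using nz
proof (induction K)
  case 0
  show ?case by (simp add: quad_num_def quad_coeff_def) algebra
next
  case (Suc K)
  define x where "x = p ^ K"
  define B where "B = quad_coeff p A c (Suc K)"
  define v where "v = (\<Prod>j<K. e - p ^ (2 * j))"
  define Y where "Y = cleared_sum p A c (e * p\<^sup>2) K"
  define y where "y = cleared_sum p A c e K"
  have pw: "p ^ (K + 1) = p * x" "p ^ (K + 2) = p\<^sup>2 * x" "p ^ (Suc K + 1) = p\<^sup>2 * x" 
    "p ^ (Suc K + 2) = p ^ 3 * x" "p ^ (3 * Suc K) = p ^ 3 * x ^ 3" "p ^ (2 * K) = x\<^sup>2" "p ^ Suc K = p * x"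
    "p ^ (2 * K + 1) = p * x\<^sup>2" "p ^ (2 * K + 2) = p\<^sup>2 * x\<^sup>2" "p ^ (4 * K + 3) = p ^ 3 * x ^ 4"
    "p ^ (2 * Suc K + 1) = p ^ 3 * x\<^sup>2"
    by (simp_all add: x_def power_add power_mult power2_eq_square power3_eq_cube power4_eq_xxxx)
       (simp_all add: power_mult[symmetric] power_add[symmetric] power_mult_distrib algebra_simps numeral_eq_Suc)?
  have B: "quad_coeff p A c K * (A * (p * x) * (1 - A * x) * quad_num p c K)
      = B * ((1 - p\<^sup>2 * x\<^sup>2) * quad_den p A c K)"
  proof -
    have "1 - p\<^sup>2 * x\<^sup>2 \<noteq> 0" "quad_den p A c K \<noteq> 0"
      using Suc.prems[of K] unfolding pw by blast+
    moreover have "B = quad_coeff p A c K * (A * (p * x) * (1 - A * x) * quad_num p c K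
        / ((1 - p\<^sup>2 * x\<^sup>2) * quad_den p A c K))"
      by (simp only: B_def quad_coeff_def prod.lessThan_Suc pw x_def[symmetric])
    ultimately show ?thesis by simp
  qed
  have IH: "(1 - A * p * e * c + A\<^sup>2 * p ^ 3 * e\<^sup>2) * Y - (1 - A * (p * x) * e) * (1 - A * (p\<^sup>2 * x) * e) * y
     = e * (B * ((1 - p\<^sup>2 * x\<^sup>2) * quad_den p A c K)) * v"
    using Suc unfolding B[symmetric] Y_def y_def v_def
    by (simp add: pw x_def[symmetric] mult_ac power2_eq_square)
  have Y': "cleared_sum p A c (e * p\<^sup>2) (Suc K) = (1 - A * (p ^ 3 * x) * e) * Y
      + (1 - A * (p ^ 3 * x ^ 3)) * B * ((e * p\<^sup>2 - 1) * x\<^sup>2 * v)"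
    unfolding cleared_sum.simps prod_shift_argument Y_def[symmetric] B_def[symmetric] v_def[symmetric] pw
    by (simp add: algebra_simps power2_eq_square power3_eq_cube)
  have y': "cleared_sum p A c e (Suc K) = (1 - A * (p * x) * e) * y
      + (1 - A * (p ^ 3 * x ^ 3)) * B * (v * (e - x\<^sup>2))"
    unfolding cleared_sum.simps y_def[symmetric] B_def[symmetric] v_def pw
    by (simp add: pw)
  have v': "(\<Prod>j<Suc K. e - p ^ (2 * j)) = v * (e - x\<^sup>2)"
    by (simp add: v_def pw)
  \<comment> \<open>The certificate identity, after division by the common factor of all terms.\<close>
  have poly: "(1 - A * (p ^ 3 * x) * e) * (e * ((1 - p\<^sup>2 * x\<^sup>2) * (1 - A * (p * x\<^sup>2) * c + A\<^sup>2 * (p ^ 3 * x ^ 4))))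
     + (1 - A * (p ^ 3 * x ^ 3)) * ((1 - A * p * e * c + A\<^sup>2 * p ^ 3 * e\<^sup>2) * ((e * p\<^sup>2 - 1) * x\<^sup>2)
        - (1 - A * (p\<^sup>2 * x) * e) * (1 - A * (p ^ 3 * x) * e) * (e - x\<^sup>2))
     = e * (A * (p\<^sup>2 * x) * (1 - A * (p * x)) * (1 - p * x * c + p ^ 3 * x\<^sup>2)) * (e - x\<^sup>2)"
    by algebra
  have "(1 - A * p * e * c + A\<^sup>2 * p ^ 3 * e\<^sup>2) * cleared_sum p A c (e * p\<^sup>2) (Suc K)
       - (1 - A * (p\<^sup>2 * x) * e) * (1 - A * (p ^ 3 * x) * e) * cleared_sum p A c e (Suc K)
     = (1 - A * (p ^ 3 * x) * e) * ((1 - A * p * e * c + A\<^sup>2 * p ^ 3 * e\<^sup>2) * Y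
         - (1 - A * (p * x) * e) * (1 - A * (p\<^sup>2 * x) * e) * y)
     + B * v * ((1 - A * (p ^ 3 * x ^ 3)) * ((1 - A * p * e * c + A\<^sup>2 * p ^ 3 * e\<^sup>2) * ((e * p\<^sup>2 - 1) * x\<^sup>2)
        - (1 - A * (p\<^sup>2 * x) * e) * (1 - A * (p ^ 3 * x) * e) * (e - x\<^sup>2)))"
    unfolding Y' y' by (simp add: ring_distribs mult_ac)
  also have "\<dots> = B * v * ((1 - A * (p ^ 3 * x) * e) * (e * ((1 - p\<^sup>2 * x\<^sup>2) * quad_den p A c K))
     + (1 - A * (p ^ 3 * x ^ 3)) * ((1 - A * p * e * c + A\<^sup>2 * p ^ 3 * e\<^sup>2) * ((e * p\<^sup>2 - 1) * x\<^sup>2)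
        - (1 - A * (p\<^sup>2 * x) * e) * (1 - A * (p ^ 3 * x) * e) * (e - x\<^sup>2)))"
    unfolding IH by (simp add: ring_distribs mult_ac)
  also have "\<dots> = B * v * (e * (A * (p\<^sup>2 * x) * (1 - A * (p * x)) * quad_num p c (Suc K)) * (e - x\<^sup>2))"
    unfolding quad_den_def quad_num_def pw poly ..
  finally show ?case
    unfolding pw v' B_def[symmetric] by (simp add: mult_ac)
qed

text \<open>The recurrence of \<open>cleared_sum_step\<close> is homogeneous at \<open>e = p\<^sup>2\<^sup>m\<close> for \<open>m < K\<close>, so it is solved by a product; at
\<open>e = 1\<close> all terms but the first vanish.\<close>

theorem cleared_sum_closed_form:
  assumes nz: "\<And>j. j < K \<Longrightarrow> 1 - p ^ (2 * j + 2) \<noteq> 0" "\<And>j. j < K \<Longrightarrow> quad_den p A c j \<noteq> 0"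
  assumes "m \<le> K"
  shows "cleared_sum p A c (p ^ (2 * m)) K * (\<Prod>j<m. quad_den p A c j) = (\<Prod>j<K + 1 + 2 * m. 1 - A * p ^ j)"
  using assms(3)
proof (induction m)
  case 0
  have "cleared_sum p A c 1 K = (\<Prod>j<K + 1. 1 - A * p ^ j)" for K
  proof (induction K)
    case (Suc K)
    have "(\<Prod>j<Suc K. 1 - p ^ (2 * j)) = (0::'a)"
      by (subst prod.lessThan_Suc_shift) simp
    then have "cleared_sum p A c 1 (Suc K) = (1 - A * p ^ (K + 1)) * cleared_sum p A c 1 K"
      by (simp only: cleared_sum.simps mult_zero_right add_0_right mult_1_right)
    then show ?case using Suc by (simp add: mult_ac)
  qed simp
  then show ?case by simp
next
  case (Suc m)
  have v: "(\<Prod>j<K. p ^ (2 * m) - p ^ (2 * j)) = 0"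
    using Suc.prems by (subst prod_zero_iff) auto
  have e: "p ^ (2 * Suc m) = p ^ (2 * m) * p\<^sup>2"
    by (simp add: power_add[symmetric] del: power_Suc)
  have D: "1 - A * p * p ^ (2 * m) * c + A\<^sup>2 * p ^ 3 * (p ^ (2 * m))\<^sup>2 = quad_den p A c m"
    by (simp add: quad_den_def power_add power_mult[symmetric] mult_ac)
  have rec: "quad_den p A c m * cleared_sum p A c (p ^ (2 * Suc m)) K
      = (1 - A * p ^ (K + 1 + 2 * m)) * (1 - A * p ^ (K + 2 + 2 * m)) * cleared_sum p A c (p ^ (2 * m)) K"
    using cleared_sum_step[of K p A c "p ^ (2 * m)"] nz unfolding v D e by (simp add: power_add mult_ac)
  have "cleared_sum p A c (p ^ (2 * Suc m)) K * (\<Prod>j<Suc m. quad_den p A c j)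
      = (quad_den p A c m * cleared_sum p A c (p ^ (2 * Suc m)) K) * (\<Prod>j<m. quad_den p A c j)"
    by (simp add: mult_ac del: power_Suc)
  also have "\<dots> = (1 - A * p ^ (K + 1 + 2 * m)) * (1 - A * p ^ (K + 2 + 2 * m)) * (\<Prod>j<K + 1 + 2 * m. 1 - A * p ^ j)"
    unfolding rec using Suc by (simp add: mult_ac)
  also have "\<dots> = (\<Prod>j<Suc (Suc (K + 1 + 2 * m)). 1 - A * p ^ j)"
    unfolding prod.lessThan_Suc by (simp add: mult_ac)
  finally show ?case by simp
qed

lemma quad_sum_closed_form:
  assumes "\<And>j. 1 - p ^ (2 * j + 2) \<noteq> 0" "\<And>j. quad_den p A c j \<noteq> 0"
    and "\<And>j. 1 - A * p ^ (j + 1) * p ^ (2 * m) \<noteq> 0" "m \<le> K"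
  shows "quad_sum p A c (p ^ (2 * m)) K * (\<Prod>j<m. quad_den p A c j) = (\<Prod>j<2 * m + 1. 1 - A * p ^ j)"
proof -
  have prod_add: "(\<Prod>j<M + L. f j) = (\<Prod>j<M. f j) * (\<Prod>j<L. f (M + j))" for f :: "nat \<Rightarrow> 'a" and M L
    by (induction L) (simp_all add: mult.assoc)
  define N where "N = (\<Prod>j<K. 1 - A * p ^ (j + 1) * p ^ (2 * m))"
  have N: "N \<noteq> 0" unfolding N_def by (subst prod_zero_iff) (use assms(3) in auto)
  have "N = (\<Prod>j<K. 1 - A * p ^ (2 * m + 1 + j))"
    unfolding N_def by (rule prod.cong) (simp_all add: power_add mult_ac)
  then have split: "(\<Prod>j<K + 1 + 2 * m. 1 - A * p ^ j) = (\<Prod>j<2 * m + 1. 1 - A * p ^ j) * N"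
    using prod_add[of "\<lambda>j. 1 - A * p ^ j" "2 * m + 1" K] by (simp add: add_ac)
  have "N * (quad_sum p A c (p ^ (2 * m)) K * (\<Prod>j<m. quad_den p A c j)) = N * (\<Prod>j<2 * m + 1. 1 - A * p ^ j)"
    using cleared_sum_closed_form[of K p A c m] cleared_sum_eq[of K A p "p ^ (2 * m)" c] assms
    unfolding split N_def by (simp add: mult_ac)
  then show ?thesis using N by simp
qed

section \<open>Congruences and first-order expansions in a subring of a field\<close>

text \<open>Denominators are invertible in the field, but a congruence can be divided only by elements whose inverse stays in the
subring; these are the \<open>units\<close> below.\<close>

locale subring_with_modulus =
  fixes R :: "'a::field set" and d :: 'a
  assumes zero_closed [simp]: "0 \<in> R" and one_closed [simp]: "1 \<in> R"
    and add_closed [simp]: "x \<in> R \<Longrightarrow> y \<in> R \<Longrightarrow> x + y \<in> R"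
    and uminus_closed [simp]: "x \<in> R \<Longrightarrow> - x \<in> R"
    and mult_closed [simp]: "x \<in> R \<Longrightarrow> y \<in> R \<Longrightarrow> x * y \<in> R"
    and modulus_closed [simp]: "d \<in> R"
begin

lemma diff_closed [simp]: "x \<in> R \<Longrightarrow> y \<in> R \<Longrightarrow> x - y \<in> R"
  using add_closed[of x "- y"] by simp

lemma power_closed [simp]: "x \<in> R \<Longrightarrow> x ^ k \<in> R"
  by (induction k) auto

lemma of_nat_closed [simp]: "of_nat k \<in> R"
  by (induction k) auto

lemma numeral_closed [simp]: "numeral k \<in> R"
  using of_nat_closed[of "numeral k"] by simp

lemma sum_closed: "(\<And>i. i \<in> I \<Longrightarrow> f i \<in> R) \<Longrightarrow> sum f I \<in> R"
  by (induction I rule: infinite_finite_induct) auto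

lemma prod_closed: "(\<And>i. i \<in> I \<Longrightarrow> f i \<in> R) \<Longrightarrow> prod f I \<in> R"
  by (induction I rule: infinite_finite_induct) auto

definition units :: "'a set" where
  "units = {x \<in> R. x \<noteq> 0 \<and> inverse x \<in> R}"

lemma units_closed: "x \<in> units \<Longrightarrow> x \<in> R"
  and units_nonzero: "x \<in> units \<Longrightarrow> x \<noteq> 0"
  and inverse_units: "x \<in> units \<Longrightarrow> inverse x \<in> R"
  by (auto simp: units_def)

lemma units_mult: "x \<in> units \<Longrightarrow> y \<in> units \<Longrightarrow> x * y \<in> units"
  by (auto simp: units_def)

lemma units_1: "1 \<in> units"
  by (auto simp: units_def)

lemma units_power: "x \<in> units \<Longrightarrow> x ^ k \<in> units"
  by (induction k) (auto intro: units_mult units_1)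

lemma units_prod: "(\<And>i. i \<in> I \<Longrightarrow> f i \<in> units) \<Longrightarrow> prod f I \<in> units"
  by (induction I rule: infinite_finite_induct) (auto intro: units_mult units_1)

lemma divide_closed: "x \<in> R \<Longrightarrow> y \<in> units \<Longrightarrow> x / y \<in> R"
  by (simp add: divide_inverse inverse_units)

definition cong_mod :: "'a \<Rightarrow> 'a \<Rightarrow> 'a \<Rightarrow> bool" where
  "cong_mod m x y \<longleftrightarrow> (\<exists>w\<in>R. x - y = m * w)"

lemma cong_refl [simp]: "cong_mod m x x"
  unfolding cong_mod_def by (intro bexI[of _ 0]) auto

lemma cong_sym: "cong_mod m x y \<Longrightarrow> cong_mod m y x"
  unfolding cong_mod_def
proof (elim bexE)
  fix w assume "w \<in> R" "x - y = m * w"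
  then show "\<exists>w\<in>R. y - x = m * w"
    by (intro bexI[of _ "- w"]) (auto simp: algebra_simps)
qed

lemma cong_trans [trans]: "cong_mod m x y \<Longrightarrow> cong_mod m y z \<Longrightarrow> cong_mod m x z"
  unfolding cong_mod_def
proof (elim bexE)
  fix v w assume "v \<in> R" "w \<in> R" "x - y = m * v" "y - z = m * w"
  then show "\<exists>w\<in>R. x - z = m * w"
    by (intro bexI[of _ "v + w"]) (auto simp: algebra_simps)
qed

lemma cong_eq_trans [trans]: "cong_mod m x y \<Longrightarrow> y = z \<Longrightarrow> cong_mod m x z"
  and eq_cong_trans [trans]: "x = y \<Longrightarrow> cong_mod m y z \<Longrightarrow> cong_mod m x z"
  by simp_all

lemma cong_add: "cong_mod m x y \<Longrightarrow> cong_mod m x' y' \<Longrightarrow> cong_mod m (x + x') (y + y')"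
  unfolding cong_mod_def
proof (elim bexE)
  fix v w assume "v \<in> R" "w \<in> R" "x - y = m * v" "x' - y' = m * w"
  then show "\<exists>w\<in>R. x + x' - (y + y') = m * w"
    by (intro bexI[of _ "v + w"]) (auto simp: algebra_simps)
qed

lemma cong_mult_left: "a \<in> R \<Longrightarrow> cong_mod m x y \<Longrightarrow> cong_mod m (a * x) (a * y)"
  unfolding cong_mod_def
proof (elim bexE)
  fix w assume "a \<in> R" "w \<in> R" "x - y = m * w"
  then show "\<exists>w\<in>R. a * x - a * y = m * w"
    by (intro bexI[of _ "a * w"]) (auto simp: right_diff_distrib[symmetric])
qed

lemma cong_uminus: "cong_mod m x y \<Longrightarrow> cong_mod m (- x) (- y)"
  using cong_mult_left[of "- 1" m x y] by simp

lemma cong_diff: "cong_mod m x y \<Longrightarrow> cong_mod m x' y' \<Longrightarrow> cong_mod m (x - x') (y - y')"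
  using cong_add[of m x y "- x'" "- y'"] cong_uminus[of m x' y'] by simp

lemma cong_mult:
  assumes "cong_mod m x y" "cong_mod m x' y'" "x' \<in> R" "y \<in> R"
  shows "cong_mod m (x * x') (y * y')"
proof -
  have "cong_mod m (x' * x) (x' * y)" "cong_mod m (y * x') (y * y')"
    using assms by (auto intro: cong_mult_left)
  then show ?thesis
    by (metis cong_trans mult.commute)
qed

lemma cong_prod:
  assumes "\<And>i. i \<in> I \<Longrightarrow> cong_mod m (f i) (g i)" "\<And>i. i \<in> I \<Longrightarrow> f i \<in> R" "\<And>i. i \<in> I \<Longrightarrow> g i \<in> R"
  shows "cong_mod m (prod f I) (prod g I)"
  using assms
  by (induction I rule: infinite_finite_induct) (auto intro!: cong_mult prod_closed)

lemma cong_power: "cong_mod m x y \<Longrightarrow> x \<in> R \<Longrightarrow> y \<in> R \<Longrightarrow> cong_mod m (x ^ k) (y ^ k)"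
  using cong_prod[of "{..<k}" m "\<lambda>_. x" "\<lambda>_. y"] by simp

lemma cong_divide:
  assumes "cong_mod m x y" "cong_mod m u v" "y \<in> R" "u \<in> units" "v \<in> units"
  shows "cong_mod m (x / u) (y / v)"
proof -
  obtain a b where ab: "a \<in> R" "b \<in> R" "x - y = m * a" "u - v = m * b"
    using assms(1,2) by (auto simp: cong_mod_def)
  have nz: "u \<noteq> 0" "v \<noteq> 0" using assms units_nonzero by auto
  have x: "x = y + m * a" and u: "v = u - m * b" using ab by (auto simp: algebra_simps)
  have "x / u - y / v = (x * v - y * u) / (u * v)"
    using nz by (simp add: field_simps)
  also have "x * v - y * u = m * (a * v - y * b)"
    unfolding x using u by algebra
  finally have "x / u - y / v = m * ((a * v - y * b) / (u * v))" by simp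
  moreover have "(a * v - y * b) / (u * v) \<in> R"
    using ab assms by (intro divide_closed units_mult) (auto simp: units_closed)
  ultimately show ?thesis unfolding cong_mod_def by blast
qed

lemma cong_cancel:
  assumes "cong_mod m (x * u) (y * u)" "u \<in> units"
  shows "cong_mod m x y"
  using cong_mult_left[OF inverse_units[OF assms(2)] assms(1)] units_nonzero[OF assms(2)]
  by (simp add: mult.commute[of _ u] mult.assoc[symmetric])

lemma cong_scale: "cong_mod m x y \<Longrightarrow> cong_mod (k * m) (k * x) (k * y)"
  unfolding cong_mod_def by (auto simp: right_diff_distrib[symmetric] mult.assoc)

lemma cong_sum: "(\<And>i. i \<in> I \<Longrightarrow> cong_mod m (f i) (g i)) \<Longrightarrow> cong_mod m (sum f I) (sum g I)"
  by (induction I rule: infinite_finite_induct) (auto intro: cong_add)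

text \<open>The families that occur are built from \<open>q\<^bsup>-rn\<^esup>\<close> and \<open>q\<^bsup>sn\<^esup>\<close>, with \<open>d = 1 - q\<^sup>n\<close>. Being affine modulo \<open>d\<^sup>2\<close> is
inherited by sums, products and inverses of units, and replaces an expansion in two independent parameters.\<close>

definition affine_family :: "(nat \<Rightarrow> nat \<Rightarrow> 'a) \<Rightarrow> bool" where
  "affine_family f \<longleftrightarrow> (\<forall>r s. f r s \<in> R) \<and> (\<exists>x\<in>R. \<exists>y\<in>R. \<forall>r s.
     cong_mod (d\<^sup>2) (f r s) (f 0 0 + d * (of_nat r * x + of_nat s * y)))"

lemma affine_familyI:
  assumes "a \<in> R" "x \<in> R" "y \<in> R"
    and "\<And>r s. \<exists>w\<in>R. f r s = a + d * (of_nat r * x + of_nat s * y) + d\<^sup>2 * w"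
  shows "affine_family f"
proof -
  have "f r s \<in> R" for r s
    using assms(4)[of r s] assms(1-3) by (auto intro!: add_closed mult_closed power_closed)
  moreover have "cong_mod (d\<^sup>2) (f r s) (f 0 0 + d * (of_nat r * x + of_nat s * y))" for r s
  proof -
    obtain v w where "v \<in> R" "w \<in> R" "f r s = a + d * (of_nat r * x + of_nat s * y) + d\<^sup>2 * w"
      "f 0 0 = a + d\<^sup>2 * v"
      using assms(4)[of r s] assms(4)[of 0 0] by auto
    then show ?thesis
      unfolding cong_mod_def by (intro bexI[of _ "w - v"]) (auto simp: algebra_simps)
  qed
  ultimately show ?thesis
    unfolding affine_family_def using assms by blast
qed

lemma affine_familyE:
  assumes "affine_family f"
  obtains x y w where "x \<in> R" "y \<in> R" "\<And>r s. w r s \<in> R"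
    "\<And>r s. f r s = f 0 0 + d * (of_nat r * x + of_nat s * y) + d\<^sup>2 * w r s"
proof -
  obtain x y where xy: "x \<in> R" "y \<in> R"
    "\<forall>r s. cong_mod (d\<^sup>2) (f r s) (f 0 0 + d * (of_nat r * x + of_nat s * y))"
    using assms by (auto simp: affine_family_def)
  then have "\<forall>r s. \<exists>w\<in>R. f r s = f 0 0 + d * (of_nat r * x + of_nat s * y) + d\<^sup>2 * w"
    by (auto simp: cong_mod_def algebra_simps)
  then obtain w where "\<And>r s. w r s \<in> R \<and> f r s = f 0 0 + d * (of_nat r * x + of_nat s * y) + d\<^sup>2 * w r s"
    by metis
  then show ?thesis using that xy by blast
qed

lemma affine_closed: "affine_family f \<Longrightarrow> f r s \<in> R"
  by (simp add: affine_family_def)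

lemma affine_const: "a \<in> R \<Longrightarrow> affine_family (\<lambda>_ _. a)"
  by (rule affine_familyI[of a 0 0]) (auto intro: bexI[of _ 0])

lemma affine_add:
  assumes "affine_family f" "affine_family g"
  shows "affine_family (\<lambda>r s. f r s + g r s)"
proof -
  obtain x y w where f: "x \<in> R" "y \<in> R" "\<And>r s. w r s \<in> R"
    "\<And>r s. f r s = f 0 0 + d * (of_nat r * x + of_nat s * y) + d\<^sup>2 * w r s"
    using assms(1) by (rule affine_familyE) blast
  obtain x' y' w' where g: "x' \<in> R" "y' \<in> R" "\<And>r s. w' r s \<in> R"
    "\<And>r s. g r s = g 0 0 + d * (of_nat r * x' + of_nat s * y') + d\<^sup>2 * w' r s"
    using assms(2) by (rule affine_familyE) blast
  show ?thesis
  proof (rule affine_familyI)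
    fix r s
    show "\<exists>v\<in>R. f r s + g r s = (f 0 0 + g 0 0) + d * (of_nat r * (x + x') + of_nat s * (y + y')) + d\<^sup>2 * v"
      using f(1-3) g(1-3) by (subst f(4), subst g(4), intro bexI[of _ "w r s + w' r s"]) (auto simp: algebra_simps)
  qed (use f(1-3) g(1-3) assms in \<open>auto simp: affine_closed\<close>)
qed

lemma affine_mult:
  assumes "affine_family f" "affine_family g"
  shows "affine_family (\<lambda>r s. f r s * g r s)"
proof -
  obtain x y w where f: "x \<in> R" "y \<in> R" "\<And>r s. w r s \<in> R"
    "\<And>r s. f r s = f 0 0 + d * (of_nat r * x + of_nat s * y) + d\<^sup>2 * w r s"
    using assms(1) by (rule affine_familyE) blast
  obtain x' y' w' where g: "x' \<in> R" "y' \<in> R" "\<And>r s. w' r s \<in> R"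
    "\<And>r s. g r s = g 0 0 + d * (of_nat r * x' + of_nat s * y') + d\<^sup>2 * w' r s"
    using assms(2) by (rule affine_familyE) blast
  define a b where "a = f 0 0" and "b = g 0 0"
  have ab: "a \<in> R" "b \<in> R" using assms by (auto simp: affine_closed a_def b_def)
  show ?thesis
  proof (rule affine_familyI)
    fix r s
    define l l' where "l = of_nat r * x + of_nat s * y" and "l' = of_nat r * x' + of_nat s * y'"
    have l: "l \<in> R" "l' \<in> R" unfolding l_def l'_def using f(1-3) g(1-3) by auto
    have "f r s * g r s = (a + d * l + d\<^sup>2 * w r s) * (b + d * l' + d\<^sup>2 * w' r s)"
      unfolding l_def l'_def a_def b_def using f(4) g(4) by metis
    also have "\<dots> = a * b + d * (l * b + a * l')
        + d\<^sup>2 * (l * l' + a * w' r s + b * w r s + d * (l * w' r s + l' * w r s) + d\<^sup>2 * (w r s * w' r s))"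
      by (simp add: ring_distribs power2_eq_square mult_ac add_ac)
    also have "l * b + a * l' = of_nat r * (x * b + a * x') + of_nat s * (y * b + a * y')"
      unfolding l_def l'_def by (simp add: ring_distribs mult_ac add_ac)
    finally show "\<exists>v\<in>R. f r s * g r s = a * b
        + d * (of_nat r * (x * b + a * x') + of_nat s * (y * b + a * y')) + d\<^sup>2 * v"
      by (rule bexI) (use f(1-3) g(1-3) l ab in auto)
  qed (use f(1-3) g(1-3) ab in auto)
qed

lemma affine_diff:
  assumes "affine_family f" "affine_family g"
  shows "affine_family (\<lambda>r s. f r s - g r s)"
  using affine_add[OF assms(1) affine_mult[OF affine_const[of "- 1"] assms(2)]] by simp

text \<open>If \<open>f = f\<^sub>0 + u\<close> with \<open>u\<close> divisible by \<open>d\<close>, and \<open>i\<close> is the inverse of \<open>f\<^sub>0\<close>, then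
\<open>1/f = i - i\<^sup>2 u + i\<^sup>2 u\<^sup>2/f\<close>, and the last summand is divisible by \<open>d\<^sup>2\<close>.\<close>

lemma affine_inverse:
  assumes "affine_family f" "\<And>r s. f r s \<in> units"
  shows "affine_family (\<lambda>r s. inverse (f r s))"
proof -
  obtain x y w where f: "x \<in> R" "y \<in> R" "\<And>r s. w r s \<in> R"
    "\<And>r s. f r s = f 0 0 + d * (of_nat r * x + of_nat s * y) + d\<^sup>2 * w r s"
    using assms(1) by (rule affine_familyE) blast
  define i where "i = inverse (f 0 0)"
  have i: "i \<in> R" "f 0 0 * i = 1" "f 0 0 \<in> R"
    using assms(2) units_nonzero by (auto simp: i_def inverse_units units_closed)
  show ?thesis
  proof (rule affine_familyI)
    fix r s
    define l where "l = of_nat r * x + of_nat s * y"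
    define g where "g = inverse (f r s)"
    have l: "l \<in> R" unfolding l_def using f(1-3) by auto
    have g: "g \<in> R" "f r s * g = 1"
      using assms(2) units_nonzero by (auto simp: g_def inverse_units)
    have e: "f r s = f 0 0 + d * l + d\<^sup>2 * w r s" unfolding l_def by (rule f(4))
    define u where "u = d * l + d\<^sup>2 * w r s"
    have "i * ((f 0 0 + u) * g) = i" using e g(2) by (simp add: u_def add.assoc)
    then have gi: "g = i - g * i * u"
      using i(2) by (simp add: ring_distribs mult.assoc[symmetric] mult.commute[of i]) (simp add: mult_ac eq_diff_eq)
    have "g = i - (i - g * i * u) * i * u" by (subst gi[symmetric]) (rule gi)
    also have "\<dots> = i - i\<^sup>2 * u + g * i\<^sup>2 * u\<^sup>2"
      by (simp add: ring_distribs power2_eq_square mult_ac)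
    also have "\<dots> = i + d * (of_nat r * (- (x * i\<^sup>2)) + of_nat s * (- (y * i\<^sup>2)))
        + d\<^sup>2 * (g * i\<^sup>2 * (l + d * w r s)\<^sup>2 - i\<^sup>2 * w r s)"
      unfolding u_def l_def by (simp add: ring_distribs power2_eq_square mult_ac)
    finally have "g = i + d * (of_nat r * (- (x * i\<^sup>2)) + of_nat s * (- (y * i\<^sup>2)))
        + d\<^sup>2 * (g * i\<^sup>2 * (l + d * w r s)\<^sup>2 - i\<^sup>2 * w r s)" .
    then show "\<exists>v\<in>R. inverse (f r s) = i + d * (of_nat r * (- (x * i\<^sup>2)) + of_nat s * (- (y * i\<^sup>2))) + d\<^sup>2 * v"
      unfolding g_def[symmetric] by (rule bexI) (use l g(1) i(1) f(3) in auto)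
  qed (use f(1-3) i in auto)
qed

lemma affine_divide:
  assumes "affine_family f" "affine_family g" "\<And>r s. g r s \<in> units"
  shows "affine_family (\<lambda>r s. f r s / g r s)"
  unfolding divide_inverse using assms by (intro affine_mult affine_inverse)

lemma affine_prod: "(\<And>i. i \<in> I \<Longrightarrow> affine_family (f i)) \<Longrightarrow> affine_family (\<lambda>r s. \<Prod>i\<in>I. f i r s)"
  by (induction I rule: infinite_finite_induct) (auto intro: affine_mult affine_const)

lemma affine_sum: "(\<And>i. i \<in> I \<Longrightarrow> affine_family (f i)) \<Longrightarrow> affine_family (\<lambda>r s. \<Sum>i\<in>I. f i r s)"
  by (induction I rule: infinite_finite_induct) (auto intro: affine_add affine_const)

lemma power_one_minus: "\<exists>w\<in>R. (1 - d) ^ s = 1 - of_nat s * d + d\<^sup>2 * w"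
proof (induction s)
  case 0
  show ?case by (auto intro: bexI[of _ 0])
next
  case (Suc s)
  then obtain w where w: "w \<in> R" "(1 - d) ^ s = 1 - of_nat s * d + d\<^sup>2 * w" by blast
  have "(1 - d) ^ Suc s = 1 - of_nat (Suc s) * d + d\<^sup>2 * (of_nat s + w - d * w)"
    unfolding power_Suc2 w(2) by (simp add: algebra_simps power2_eq_square)
  then show ?case by (rule bexI) (use w(1) in auto)
qed

lemma affine_power_right: "affine_family (\<lambda>r s. (1 - d) ^ s)"
proof (rule affine_familyI[of 1 0 "- 1"])
  fix r s :: nat
  show "\<exists>w\<in>R. (1 - d) ^ s = 1 + d * (of_nat r * 0 + of_nat s * - 1) + d\<^sup>2 * w"
    using power_one_minus[of s] by (simp add: mult.commute)
qed auto

lemma affine_power_left: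
  assumes "1 - d \<in> units"
  shows "affine_family (\<lambda>r s. inverse (1 - d) ^ r)"
proof -
  have "affine_family (\<lambda>r s. (1 - d) ^ r)"
  proof (rule affine_familyI[of 1 "- 1" 0])
    fix r s :: nat
    show "\<exists>w\<in>R. (1 - d) ^ r = 1 + d * (of_nat r * - 1 + of_nat s * 0) + d\<^sup>2 * w"
      using power_one_minus[of r] by (simp add: mult.commute)
  qed auto
  then have "affine_family (\<lambda>r s. inverse ((1 - d) ^ r))"
    using assms by (intro affine_inverse) (auto intro: units_power)
  then show ?thesis by (simp add: power_inverse)
qed

text \<open>Two zeros with the same \<open>r\<close> show that the slope in \<open>s\<close>, multiplied by \<open>7 - 3\<close> and by \<open>d\<close>, is divisible by \<open>d\<^sup>2\<close>. The
slope does not depend on \<open>r\<close>, so along \<open>r = 0\<close> the family is constant modulo \<open>d\<^sup>2\<close>.\<close>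

lemma affine_family_vanishing:
  assumes "affine_family f" "f 1 3 = 0" "f 1 7 = 0" "4 \<in> units"
  shows "cong_mod (d\<^sup>2) (f 0 3) (f 0 0)"
proof -
  obtain x y w where f: "x \<in> R" "y \<in> R" "\<And>r s. w r s \<in> R"
    "\<And>r s. f r s = f 0 0 + d * (of_nat r * x + of_nat s * y) + d\<^sup>2 * w r s"
    using assms(1) by (rule affine_familyE) blast
  have "4 * (d * y) = d\<^sup>2 * (w 1 3 - w 1 7)"
    using f(4)[of 1 3] f(4)[of 1 7] assms(2,3) by (simp, algebra)
  then have "d * y = d\<^sup>2 * (inverse 4 * (w 1 3 - w 1 7))"
    using units_nonzero[OF assms(4)] by (simp add: field_simps)
  then have "3 * (d * y) = d\<^sup>2 * (3 * (inverse 4 * (w 1 3 - w 1 7)))"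
    by (simp only: mult.left_commute)
  then have "f 0 3 - f 0 0 = d\<^sup>2 * (3 * (inverse 4 * (w 1 3 - w 1 7)) + w 0 3)"
    by (subst f(4)[of 0 3]) (simp add: ring_distribs mult.left_commute[of d 3])
  then show ?thesis
    unfolding cong_mod_def by (rule bexI) (intro add_closed mult_closed diff_closed numeral_closed f(3) inverse_units assms(4))
qed

end

section \<open>Rational functions with denominator prime to a cyclotomic polynomial\<close>

text \<open>Congruences are taken modulo powers of \<open>1 - q\<^sup>n\<close> instead of \<open>\<Phi>\<^sub>n(q)\<close>: since \<open>\<Phi>\<^sub>n(q)\<close> divides \<open>1 - q\<^sup>n\<close>, this is enough
(lemma \<open>ratfun_congI\<close>), and multiples of \<open>1 - q\<^sup>n\<close> are explicit.\<close>

definition local_ring :: "nat \<Rightarrow> ratfun set" where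
  "local_ring n = {to_fract f / to_fract g | f g. g \<noteq> 0 \<and> coprime g (cyclotomic n)}"

lemma q_power: "q ^ k = to_fract (monom 1 k)"
proof (induction k)
  case (Suc k)
  have "monom 1 (Suc k) = [:0, 1:] * (monom 1 k :: rat poly)"
    by (simp add: monom_Suc)
  then show ?case using Suc by (simp add: q_def del: mult_pCons_left)
qed (simp add: monom_0 one_pCons[symmetric])

lemma q_nonzero [simp]: "q \<noteq> 0"
  by (simp add: q_def)

lemma q_power_inject [simp]: "q ^ i = q ^ j \<longleftrightarrow> i = j"
  by (auto simp: q_power monom_eq_iff')

lemma q_power_eq_1 [simp]: "q ^ k = 1 \<longleftrightarrow> k = 0"
  using q_power_inject[of k 0] by simp

text \<open>A root of \<open>\<Phi>\<^sub>n\<close> has multiplicative order exactly \<open>n\<close>.\<close>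

lemma cyclotomic_root_power_eq:
  assumes "n > 0" "poly (complex_cyclotomic n) z = 0" "z ^ i = z ^ j"
  shows "i mod n = j mod n"
  using assms(3)
proof (induction i j rule: linorder_wlog)
  case (le i j)
  obtain k where k: "coprime n k" "z = cis (2 * pi / real n) ^ k"
    using assms(2) unfolding complex_cyclotomic_def poly_prod
    by (subst (asm) prod_zero_iff) auto
  have z0: "z \<noteq> 0" using k by simp
  have "z ^ i * z ^ (j - i) = z ^ j" using le(1) by (simp flip: power_add)
  then have "z ^ (j - i) = 1" using z0 le by simp
  then have "cis (2 * pi / real n * real (k * (j - i))) = 1"
    unfolding k(2) power_mult[symmetric] DeMoivre by (simp add: mult_ac)
  then have "cos (2 * pi / real n * real (k * (j - i))) = 1"
    by (metis cis.sel(1) one_complex.sel(1))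
  then obtain m :: int where m: "2 * pi / real n * real (k * (j - i)) = real_of_int m * (2 * pi)"
    unfolding cos_one_2pi_int by (auto simp: mult_ac)
  then have "real (k * (j - i)) = real_of_int m * real n"
    using assms(1) by (simp add: field_simps)
  then have "int (k * (j - i)) = m * int n"
    by (metis (mono_tags, opaque_lifting) of_int_eq_iff of_int_mult of_int_of_nat_eq)
  then have "int n dvd int (k * (j - i))" by simp
  then have "n dvd k * (j - i)" by (simp only: int_dvd_int_iff)
  then have "n dvd j - i" using k(1) by (simp add: coprime_dvd_mult_right_iff)
  then show ?case using le by (metis mod_eq_dvd_iff_nat)
next
  case (sym i j)
  then show ?case by simp
qed

lemma rat_poly_complex_root:
  assumes "degree (p :: rat poly) > 0"
  shows "\<exists>z::complex. poly (map_poly of_rat p) z = 0"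
  using assms by (intro alg_closed_imp_poly_has_root) (simp add: of_rat_poly_degree)

text \<open>A common factor of positive degree over the rationals would have a complex root.\<close>

lemma coprime_cyclotomic:
  assumes "p \<noteq> 0" "\<And>z. poly (complex_cyclotomic n) z = 0 \<Longrightarrow> poly (map_poly of_rat p) z \<noteq> (0::complex)"
  shows "coprime p (cyclotomic n)"
proof (rule coprimeI)
  fix c assume c: "c dvd p" "c dvd cyclotomic n"
  obtain u v where u: "p = c * u" "cyclotomic n = c * v"
    using c by (auto elim!: dvdE)
  show "is_unit c"
  proof (rule ccontr)
    assume "\<not> is_unit c"
    moreover have "c \<noteq> 0" using assms(1) u by auto
    ultimately have "degree c > 0" by (simp add: is_unit_iff_degree)
    then obtain z :: complex where "poly (map_poly of_rat c) z = 0"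
      using rat_poly_complex_root by blast
    then have "poly (map_poly of_rat p) z = 0" "poly (complex_cyclotomic n) z = 0"
      by (simp_all add: u of_rat_cyclotomic[symmetric] of_rat_poly_mult)
    then show False using assms(2) by blast
  qed
qed

lemma coprime_monom_diff_cyclotomic:
  assumes "n > 0" "i mod n \<noteq> j mod n"
  shows "coprime (monom 1 i - monom 1 j) (cyclotomic n)"
proof (rule coprime_cyclotomic)
  show "monom 1 i - monom 1 j \<noteq> (0 :: rat poly)"
    using assms(2) by (auto simp: monom_eq_iff')
  fix z assume "poly (complex_cyclotomic n) z = 0"
  then have "z ^ i \<noteq> z ^ j" using cyclotomic_root_power_eq[OF assms(1)] assms(2) by blast
  moreover have "map_poly of_rat (monom 1 i - monom 1 j) = (monom 1 i - monom 1 j :: complex poly)"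
    by (rule poly_eqI) (simp add: coeff_map_poly of_rat_diff coeff_monom)
  ultimately show "poly (map_poly of_rat (monom 1 i - monom 1 j)) z \<noteq> 0"
    by (simp add: poly_monom)
qed

lemma cyclotomic_dvd: 
  assumes "n > 0"
  shows "cyclotomic n dvd 1 - monom 1 n"
proof -
  let ?h = "map_poly of_rat :: rat poly \<Rightarrow> complex poly"
  have "complex_cyclotomic n dvd (\<Prod>d | d dvd n. complex_cyclotomic d)"
    using assms by (intro dvd_prodI) auto
  then obtain c where "monom 1 n - 1 = complex_cyclotomic n * c"
    using prod_complex_cyclotomic[OF assms] by (auto elim!: dvdE)
  then have c: "?h (cyclotomic n) * (- c) = ?h (1 - monom 1 n)"
    by (simp add: of_rat_cyclotomic) 
       (rule poly_eqI, simp add: coeff_map_poly of_rat_diff coeff_monom flip: \<open>monom 1 n - 1 = complex_cyclotomic n * c\<close>)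
  have "cyclotomic n \<noteq> 0"
    by (metis complex_cyclotomic_nonzero map_poly_0 of_rat_cyclotomic)
  then obtain s where "?h s = - c"
    using of_rat_poly_quotient[OF c] by blast
  then have "?h (cyclotomic n * s) = ?h (1 - monom 1 n)"
    using c by (simp add: of_rat_poly_mult)
  then show ?thesis
    by (metis dvd_triv_left of_rat_poly_inj)
qed

lemma local_ringI: "g \<noteq> 0 \<Longrightarrow> coprime g (cyclotomic n) \<Longrightarrow> to_fract f / to_fract g \<in> local_ring n"
  by (auto simp: local_ring_def)

lemma to_fract_local_ring: "to_fract f \<in> local_ring n"
  using local_ringI[of 1 n f] by simp

lemma subring_local_ring: "subring_with_modulus (local_ring n) (1 - q ^ n)"
proof
  show "0 \<in> local_ring n" "1 \<in> local_ring n"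
    using to_fract_local_ring[of 0 n] to_fract_local_ring[of 1 n] by simp_all
  show "1 - q ^ n \<in> local_ring n"
    using to_fract_local_ring[of "1 - monom 1 n" n] by (simp add: q_power)
  fix x assume "x \<in> local_ring n"
  then obtain f g where x: "x = to_fract f / to_fract g" "g \<noteq> 0" "coprime g (cyclotomic n)"
    by (auto simp: local_ring_def)
  show "- x \<in> local_ring n"
    using local_ringI[OF x(2,3), of "- f"] x by simp
  fix y assume "y \<in> local_ring n"
  then obtain f' g' where y: "y = to_fract f' / to_fract g'" "g' \<noteq> 0" "coprime g' (cyclotomic n)"
    by (auto simp: local_ring_def)
  have g: "g * g' \<noteq> 0" "coprime (g * g') (cyclotomic n)" using x y by auto
  show "x * y \<in> local_ring n"
    using local_ringI[OF g, of "f * f'"] x y by simp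
  have "x + y = to_fract (f * g' + f' * g) / to_fract (g * g')"
    using x y by (simp add: field_simps)
  then show "x + y \<in> local_ring n"
    using local_ringI[OF g, of "f * g' + f' * g"] by simp
qed

lemma ratfun_congI:
  assumes "n > 0" "subring_with_modulus.cong_mod (local_ring n) ((1 - q ^ n)\<^sup>2) A B"
  shows "ratfun_cong A B (cyclotomic n ^ 2)"
proof -
  interpret subring_with_modulus "local_ring n" "1 - q ^ n" by (rule subring_local_ring)
  obtain w where "w \<in> local_ring n" "A - B = (1 - q ^ n)\<^sup>2 * w"
    using assms(2) by (auto simp: cong_mod_def)
  then obtain f g where w: "A - B = (1 - q ^ n)\<^sup>2 * (to_fract f / to_fract g)" "g \<noteq> 0" "coprime g (cyclotomic n)"
    by (auto simp: local_ring_def)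
  obtain c where c: "1 - monom 1 n = cyclotomic n * c"
    using cyclotomic_dvd[OF assms(1)] by (auto elim!: dvdE)
  define h where "h = (1 - monom 1 n)\<^sup>2 * f"
  define e where "e = gcd h g"
  have e: "e \<noteq> 0" using w by (simp add: e_def)
  have "coprime e (cyclotomic n ^ 2)"
    using w(3) by (auto simp: e_def intro: coprime_imp_coprime dvd_trans)
  moreover have h: "h = (h div e) * e" and g: "g = (g div e) * e" by (simp_all add: e_def)
  moreover have "cyclotomic n ^ 2 dvd h"
    by (simp add: h_def c power_mult_distrib)
  ultimately have "cyclotomic n ^ 2 dvd h div e"
    by (metis coprime_commute coprime_dvd_mult_left_iff)
  moreover have "coprime (h div e) (g div e)"
    using w(2) unfolding e_def by (intro div_gcd_coprime) auto
  moreover have "g div e \<noteq> 0" using g w(2) by auto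
  moreover have "A - B = Fract (h div e) (g div e)"
  proof -
    have "A - B = to_fract h / to_fract g"
      unfolding w(1) h_def q_power by (simp add: power2_eq_square)
    also have "\<dots> = (to_fract (h div e) * to_fract e) / (to_fract (g div e) * to_fract e)"
      using h g by (metis to_fract_mult)
    finally show ?thesis using e by (simp add: Fract_conv_to_fract)
  qed
  ultimately show ?thesis
    unfolding ratfun_cong_def by blast
qed

lemma unit_to_fract:
  assumes "f \<noteq> 0" "coprime f (cyclotomic n)"
  shows "to_fract f \<in> subring_with_modulus.units (local_ring n)"
proof -
  interpret subring_with_modulus "local_ring n" "1 - q ^ n" by (rule subring_local_ring)
  show ?thesis
    using assms local_ringI[OF assms, of 1] to_fract_local_ring[of f n]
    by (simp add: units_def inverse_eq_divide)
qed

lemma unit_q_diff: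
  assumes "n > 0" "i mod n \<noteq> j mod n"
  shows "q ^ i - q ^ j \<in> subring_with_modulus.units (local_ring n)"
proof -
  have "monom 1 i - monom 1 j \<noteq> (0 :: rat poly)"
    using assms(2) by (auto simp: monom_eq_iff')
  from unit_to_fract[OF this coprime_monom_diff_cyclotomic[OF assms]] show ?thesis
    by (simp add: q_power)
qed

lemma unit_q: 
  assumes "n > 0"
  shows "q \<in> subring_with_modulus.units (local_ring n)"
proof -
  have "coprime [:0, 1:] (cyclotomic n)"
  proof (rule coprime_cyclotomic)
    fix z assume "poly (complex_cyclotomic n) z = 0"
    then obtain k where "z = cis (2 * pi / real n) ^ k"
      unfolding complex_cyclotomic_def poly_prod by (subst (asm) prod_zero_iff) auto
    then have "z \<noteq> 0" by simp
    then show "poly (map_poly of_rat [:0, 1:]) z \<noteq> 0"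
      by (simp add: map_poly_pCons)
  qed simp
  then show ?thesis
    using unit_to_fract[of "[:0, 1:]" n] by (simp add: q_def)
qed

lemma unit_numeral: "numeral k \<in> subring_with_modulus.units (local_ring n)"
proof -
  have "to_fract (of_nat m) = of_nat m" for m by (induction m) simp_all
  from this[of "numeral k"] have "to_fract (numeral k :: rat poly) = numeral k" by simp
  moreover have "coprime (numeral k) (cyclotomic n)"
  proof (rule is_unit_left_imp_coprime)
    show "is_unit (numeral k :: rat poly)"
      by (simp add: numeral_poly is_unit_const_poly_iff dvd_field_iff)
  qed
  ultimately show ?thesis
    using unit_to_fract[of "numeral k" n] by simp
qed

lemma cyclotomic_not_unit:
  assumes "n > 0"
  shows "\<not> is_unit (cyclotomic n)"
proof
  assume "is_unit (cyclotomic n)"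
  then obtain c where c: "cyclotomic n = [:c:]" "c \<noteq> 0"
    by (metis is_unit_poly_iff not_is_unit_0)
  have "poly (complex_cyclotomic n) (cis (2 * pi / real n) ^ 1) = 0"
    unfolding complex_cyclotomic_def poly_prod
    by (rule prod_zero) (use assms in \<open>auto intro!: bexI[of _ 1]\<close>)
  then show False
    using c by (simp add: of_rat_cyclotomic[symmetric] map_poly_pCons)
qed

text \<open>If \<open>w = f/g\<close> then \<open>1 + (1 - q\<^sup>n) w\<close> has numerator \<open>g + (1 - q\<^sup>n) f\<close>, which is prime to \<open>\<Phi>\<^sub>n(q)\<close> because \<open>g\<close> is and \<open>\<Phi>\<^sub>n(q)\<close>
divides \<open>1 - q\<^sup>n\<close>.\<close>

lemma unit_of_cong_1:
  assumes "n > 0" "w \<in> local_ring n"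
  shows "1 + (1 - q ^ n) * w \<in> subring_with_modulus.units (local_ring n)"
proof -
  interpret subring_with_modulus "local_ring n" "1 - q ^ n" by (rule subring_local_ring)
  obtain f g where w: "w = to_fract f / to_fract g" "g \<noteq> 0" "coprime g (cyclotomic n)"
    using assms(2) by (auto simp: local_ring_def)
  obtain c where c: "1 - monom 1 n = cyclotomic n * c"
    using cyclotomic_dvd[OF assms(1)] by (auto elim!: dvdE)
  define h where "h = c * f * cyclotomic n + g"
  have cop: "coprime h (cyclotomic n)"
    using w(3) unfolding h_def coprime_iff_gcd_eq_1
    by (metis gcd.commute gcd_add_mult)
  have "h \<noteq> 0"
    using cop cyclotomic_not_unit[OF assms(1)] by auto
  moreover have "1 + (1 - q ^ n) * w = to_fract h / to_fract g"
  proof -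
    have "1 - q ^ n = to_fract (cyclotomic n * c)" by (simp add: q_power flip: c)
    then have "1 + (1 - q ^ n) * w = 1 + to_fract (cyclotomic n * c) * to_fract f / to_fract g"
      by (simp add: w(1))
    then show ?thesis using w(2) by (simp add: h_def field_simps)
  qed
  ultimately show ?thesis
    using cop w local_ringI[of g n h] local_ringI[of h n g]
    by (auto simp: units_def)
qed

lemma unit_of_cong:
  assumes "n > 0" "v \<in> subring_with_modulus.units (local_ring n)"
    "subring_with_modulus.cong_mod (local_ring n) (1 - q ^ n) u v"
  shows "u \<in> subring_with_modulus.units (local_ring n)"
proof -
  interpret subring_with_modulus "local_ring n" "1 - q ^ n" by (rule subring_local_ring)
  obtain w where w: "w \<in> local_ring n" "u - v = (1 - q ^ n) * w"
    using assms(3) by (auto simp: cong_mod_def)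
  have "u = v * (1 + (1 - q ^ n) * (inverse v * w))"
    using w(2) units_nonzero[OF assms(2)] by (simp add: distrib_left mult.left_commute[of v] diff_eq_eq add.commute)
  then show ?thesis
    using units_mult[OF assms(2) unit_of_cong_1[OF assms(1)]] w(1) inverse_units[OF assms(2)] by simp
qed

section \<open>First-order jets and the coefficient that gives the sum\<close>


text \<open>The variable of the series is \<open>u = a + 1/a - 2\<close>. Laurent series are used because the summation formula needs a field. Only
the coefficients of \<open>1\<close> and \<open>u\<close> are restricted: they determine those of sums, products and inverses, so no truncation
is necessary.\<close>

definition jet_ring :: "nat \<Rightarrow> ratfun fls set" where
  "jet_ring n = fps_to_fls ` {f. f $ 0 \<in> local_ring n \<and> f $ 1 \<in> local_ring n}"

lemma jet_ringI: "f $ 0 \<in> local_ring n \<Longrightarrow> f $ 1 \<in> local_ring n \<Longrightarrow> fps_to_fls f \<in> jet_ring n"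
  by (auto simp: jet_ring_def)

lemma subring_jet_ring: "subring_with_modulus (jet_ring n) (fls_const (1 - q ^ n))"
proof -
  interpret subring_with_modulus "local_ring n" "1 - q ^ n" by (rule subring_local_ring)
  show ?thesis
  proof
    show "0 \<in> jet_ring n" "1 \<in> jet_ring n"
      using jet_ringI[of 0 n] jet_ringI[of 1 n] by simp_all
    show "fls_const (1 - q ^ n) \<in> jet_ring n"
      using jet_ringI[of "fps_const (1 - q ^ n)" n] by (simp del: fps_const_sub)
    fix x assume "x \<in> jet_ring n"
    then obtain f where f: "x = fps_to_fls f" "f $ 0 \<in> local_ring n" "f $ 1 \<in> local_ring n"
      by (auto simp: jet_ring_def)
    show "- x \<in> jet_ring n"
      using jet_ringI[of "- f" n] f by simp
    fix y assume "y \<in> jet_ring n"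
    then obtain g where g: "y = fps_to_fls g" "g $ 0 \<in> local_ring n" "g $ 1 \<in> local_ring n"
      by (auto simp: jet_ring_def)
    show "x + y \<in> jet_ring n"
      using jet_ringI[of "f + g" n] f g by simp
    show "x * y \<in> jet_ring n"
      using jet_ringI[of "f * g" n] f g by (simp add: fls_times_fps_to_fls)
  qed
qed

lemma fps_inverse_nth_1:
  fixes f :: "'a::field fps"
  assumes "f $ 0 \<noteq> 0"
  shows "inverse f $ 1 = - f $ 1 * (inverse (f $ 0))\<^sup>2"
proof -
  have "f * inverse f = 1" using assms by (simp add: inverse_mult_eq_1')
  then have "(f * inverse f) $ 1 = 0" by simp
  then have "f $ 0 * inverse f $ 1 + f $ 1 * inverse (f $ 0) = 0" by (simp add: fps_mult_nth_1)
  then show ?thesis using assms by (simp add: field_simps power2_eq_square) (simp add: eq_neg_iff_add_eq_0 add.commute)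
qed

lemma inverse_fps_to_fls: 
  fixes f :: "'a::field fps"
  shows "f $ 0 \<noteq> 0 \<Longrightarrow> inverse (fps_to_fls f) = fps_to_fls (inverse f)"
  by (rule fls_inverse_fps_to_fls) (simp add: subdegree_eq_0_iff)

lemma unit_jet:
  assumes "f $ 0 \<in> subring_with_modulus.units (local_ring n)" "f $ 1 \<in> local_ring n"
  shows "fps_to_fls f \<in> subring_with_modulus.units (jet_ring n)"
proof -
  interpret R: subring_with_modulus "local_ring n" "1 - q ^ n" by (rule subring_local_ring)
  interpret J: subring_with_modulus "jet_ring n" "fls_const (1 - q ^ n)" by (rule subring_jet_ring)
  have nz: "f $ 0 \<noteq> 0" using assms(1) by (rule R.units_nonzero)
  then have "f \<noteq> 0" by auto
  moreover have "fps_to_fls (inverse f) \<in> jet_ring n"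
    using assms nz by (intro jet_ringI) (auto simp: fps_inverse_nth_1 R.inverse_units simp del: One_nat_def)
  ultimately show ?thesis
    using assms nz by (auto simp: J.units_def inverse_fps_to_fls R.units_closed intro: jet_ringI)
qed

lemma unit_const:
  assumes "x \<in> subring_with_modulus.units (local_ring n)"
  shows "fls_const x \<in> subring_with_modulus.units (jet_ring n)"
proof -
  interpret R: subring_with_modulus "local_ring n" "1 - q ^ n" by (rule subring_local_ring)
  show ?thesis
    using unit_jet[of "fps_const x" n] assms by simp
qed

lemma const_jet_ring: "x \<in> local_ring n \<Longrightarrow> fls_const x \<in> jet_ring n"
proof -
  interpret R: subring_with_modulus "local_ring n" "1 - q ^ n" by (rule subring_local_ring)
  show "x \<in> local_ring n \<Longrightarrow> fls_const x \<in> jet_ring n"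
    using jet_ringI[of "fps_const x" n] by simp
qed

lemma cong_jet_nth_1:
  assumes "subring_with_modulus.cong_mod (jet_ring n) ((fls_const (1 - q ^ n))\<^sup>2) F G"
  shows "subring_with_modulus.cong_mod (local_ring n) ((1 - q ^ n)\<^sup>2) (F $$ 1) (G $$ 1)"
proof -
  interpret R: subring_with_modulus "local_ring n" "1 - q ^ n" by (rule subring_local_ring)
  interpret J: subring_with_modulus "jet_ring n" "fls_const (1 - q ^ n)" by (rule subring_jet_ring)
  obtain w where w: "w $ 1 \<in> local_ring n" "F - G = (fls_const (1 - q ^ n))\<^sup>2 * fps_to_fls w"
    using assms unfolding J.cong_mod_def by (auto simp: jet_ring_def)
  have "(F - G) $$ 1 = (1 - q ^ n)\<^sup>2 * w $ 1"
    unfolding w(2) by (simp flip: fls_const_power)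
  then show ?thesis
    unfolding R.cong_mod_def using w(1) by auto
qed

text \<open>The product \<open>(1 - a y) (1 - y/a)\<close> as a polynomial in \<open>u\<close>.\<close>

definition quad_jet :: "ratfun \<Rightarrow> ratfun fps" where
  "quad_jet y = fps_const ((1 - y)\<^sup>2) - fps_const y * fps_X"

lemma quad_jet_nth [simp]: "quad_jet y $ 0 = (1 - y)\<^sup>2" "quad_jet y $ Suc 0 = - y"
  by (simp_all add: quad_jet_def)

text \<open>The parameter \<open>b + p/b\<close> of the quadratic sum for \<open>b = a q\<close> and \<open>p = q\<^sup>2\<close>: it equals \<open>q (a + 1/a)\<close>.\<close>

abbreviation jet_param :: "ratfun fls" where
  "jet_param \<equiv> fls_const q * (2 + fls_X)"

lemma fls_quad_jet: "fps_to_fls (quad_jet y) = 1 - fls_const y * (2 + fls_X) + (fls_const y)\<^sup>2"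
proof -
  have "fps_to_fls (quad_jet y) = fls_const ((1 - y)\<^sup>2) - fls_const y * fls_X"
    by (simp add: quad_jet_def fls_times_fps_to_fls)
  also have "fls_const ((1 - y)\<^sup>2) = (1 - fls_const y)\<^sup>2"
    by (simp add: fls_const_power flip: fls_minus_const)
  finally show ?thesis by (simp add: power2_eq_square algebra_simps)
qed

lemma quad_num_jet: "quad_num (fls_const (q\<^sup>2)) jet_param j = fps_to_fls (quad_jet (q ^ (2 * j + 1)))"
proof -
  have "fls_const (q\<^sup>2) ^ j * fls_const q = fls_const (q ^ (2 * j + 1))"
    by (simp add: mult.commute flip: fls_const_power power_mult)
  moreover have "fls_const (q\<^sup>2) ^ (2 * j + 1) = (fls_const (q ^ (2 * j + 1)))\<^sup>2"
    by (simp add: algebra_simps power2_eq_square flip: fls_const_power power_mult power_add)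
  ultimately show ?thesis
    by (simp add: quad_num_def fls_quad_jet flip: mult.assoc)
qed

lemma quad_den_jet:
  "quad_den (fls_const (q\<^sup>2)) (fls_const (q * y)) jet_param j = fps_to_fls (quad_jet (y * q ^ (4 * j + 4)))"
proof -
  have "fls_const (q * y) * fls_const (q\<^sup>2) ^ (2 * j + 1) * fls_const q = fls_const (y * q ^ (4 * j + 4))"
    by (simp flip: fls_const_power power_mult) 
       (simp add: power_add power_mult power2_eq_square power4_eq_xxxx mult_ac)
  moreover have "(fls_const (q * y))\<^sup>2 * fls_const (q\<^sup>2) ^ (4 * j + 3) = (fls_const (y * q ^ (4 * j + 4)))\<^sup>2"
    by (simp flip: fls_const_power power_mult) 
       (simp add: power_mult_distrib power_add power_mult[symmetric] algebra_simps numeral_eq_Suc)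
  ultimately show ?thesis
    by (simp add: quad_den_def fls_quad_jet flip: mult.assoc)
qed

text \<open>The \<open>k\<close>-th term of the quadratic sum with \<open>A = q\<close> and a constant \<open>e\<close> is split into the part \<open>jet_weight k\<close>, which depends on
\<open>u\<close>, and the part \<open>prefactor e k\<close>, which does not.\<close>

definition jet_weight :: "nat \<Rightarrow> ratfun fps" where
  "jet_weight k = (\<Prod>j<k. quad_jet (q ^ (2 * j + 1)) * inverse (quad_jet (q ^ (4 * j + 4))))"

definition prefactor :: "ratfun \<Rightarrow> nat \<Rightarrow> ratfun" where
  "prefactor e k = (1 - q ^ (6 * k + 1)) * (\<Prod>j<k. q ^ (2 * j + 3) * (1 - q ^ (2 * j + 1)) * (e - q ^ (4 * j))
     / ((1 - q ^ (4 * j + 4)) * (1 - q ^ (2 * j + 3) * e)))"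

lemma fps_to_fls_prod: "fps_to_fls (prod f I) = (\<Prod>i\<in>I. fps_to_fls (f i))"
  by (induction I rule: infinite_finite_induct) (auto simp: fls_times_fps_to_fls)

lemma fls_const_prod: "fls_const (prod f I) = (\<Prod>i\<in>I. fls_const (f i :: 'a::comm_semiring_1))"
  by (induction I rule: infinite_finite_induct) (auto simp flip: fls_const_mult_const)

lemma fls_const_divide: "fls_const (x / y) = fls_const x / fls_const (y :: 'a::field)"
  by (simp add: fls_const_divide_const)

lemma fls_const_inverse: "fls_const (inverse x) = inverse (fls_const (x :: 'a::field))"
  using fls_const_divide[of 1 x] by (simp add: divide_inverse)

lemma quad_sum_jet_terms:
  "(1 - fls_const q * fls_const (q\<^sup>2) ^ (3 * k)) * quad_coeff (fls_const (q\<^sup>2)) (fls_const q) jet_param k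
     * (\<Prod>j<k. (fls_const e - fls_const (q\<^sup>2) ^ (2 * j)) / (1 - fls_const q * fls_const (q\<^sup>2) ^ (j + 1) * fls_const e))
   = fls_const (prefactor e k) * fps_to_fls (jet_weight k)"
proof -
  have pw: "fls_const (q\<^sup>2) ^ i = fls_const (q ^ (2 * i))" for i
    by (simp add: power_mult flip: fls_const_power)
  have one: "1 - fls_const x = fls_const (1 - x)" for x :: ratfun
    by (simp flip: fls_minus_const)
  have inv: "inverse (fps_to_fls (quad_jet (q ^ (4 * j + 4)))) = fps_to_fls (inverse (quad_jet (q ^ (4 * j + 4))))" for j
    by (rule inverse_fps_to_fls) (simp del: power_Suc)
  have den: "quad_den (fls_const (q\<^sup>2)) (fls_const q) jet_param j = fps_to_fls (quad_jet (q ^ (4 * j + 4)))" for j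
    using quad_den_jet[of 1 j] by simp
  have "(1 - fls_const q * fls_const (q\<^sup>2) ^ (3 * k)) = fls_const (1 - q ^ (6 * k + 1))"
    unfolding pw by (simp add: one)
  moreover have "quad_coeff (fls_const (q\<^sup>2)) (fls_const q) jet_param k
     * (\<Prod>j<k. (fls_const e - fls_const (q\<^sup>2) ^ (2 * j)) / (1 - fls_const q * fls_const (q\<^sup>2) ^ (j + 1) * fls_const e))
   = fls_const (\<Prod>j<k. q ^ (2 * j + 3) * (1 - q ^ (2 * j + 1)) * (e - q ^ (4 * j))
     / ((1 - q ^ (4 * j + 4)) * (1 - q ^ (2 * j + 3) * e))) * fps_to_fls (jet_weight k)"
    unfolding quad_coeff_def jet_weight_def fps_to_fls_prod fls_const_prod prod.distrib[symmetric]
  proof (rule prod.cong)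
    fix j
    have a: "fls_const q * fls_const (q\<^sup>2) ^ (j + 1) = fls_const (q ^ (2 * j + 3))"
      "fls_const q * fls_const (q\<^sup>2) ^ j = fls_const (q ^ (2 * j + 1))"
      "fls_const (q\<^sup>2) ^ (2 * j) = fls_const (q ^ (4 * j))"
      "fls_const (q\<^sup>2) ^ (2 * j + 2) = fls_const (q ^ (4 * j + 4))"
      unfolding pw by (simp_all add: eval_nat_numeral add_ac)
    show "fls_const q * fls_const (q\<^sup>2) ^ (j + 1) * (1 - fls_const q * fls_const (q\<^sup>2) ^ j) 
        * quad_num (fls_const (q\<^sup>2)) jet_param j
        / ((1 - fls_const (q\<^sup>2) ^ (2 * j + 2)) * quad_den (fls_const (q\<^sup>2)) (fls_const q) jet_param j)
        * ((fls_const e - fls_const (q\<^sup>2) ^ (2 * j)) / (1 - fls_const q * fls_const (q\<^sup>2) ^ (j + 1) * fls_const e))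
      = fls_const (q ^ (2 * j + 3) * (1 - q ^ (2 * j + 1)) * (e - q ^ (4 * j))
          / ((1 - q ^ (4 * j + 4)) * (1 - q ^ (2 * j + 3) * e)))
        * fps_to_fls (quad_jet (q ^ (2 * j + 1)) * inverse (quad_jet (q ^ (4 * j + 4))))"
      unfolding a quad_num_jet den fls_times_fps_to_fls inv[symmetric]
      unfolding fls_const_mult_const one fls_minus_const fls_const_divide[symmetric] divide_inverse
      by (simp add: fls_const_inverse flip: fls_const_mult_const)
  qed simp
  ultimately show ?thesis
    unfolding prefactor_def fls_const_mult_const[symmetric] by (simp only: mult.assoc)
qed

lemma quad_sum_jet_nth_1:
  "quad_sum (fls_const (q\<^sup>2)) (fls_const q) jet_param (fls_const e) K $$ 1 = (\<Sum>k\<le>K. prefactor e k * jet_weight k $ 1)"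
proof -
  have sum: "(\<Sum>k\<in>I. F k) $$ 1 = (\<Sum>k\<in>I. F k $$ 1)" for I :: "nat set" and F :: "nat \<Rightarrow> ratfun fls"
    by (induction I rule: infinite_finite_induct) auto
  show ?thesis
    unfolding quad_sum_def quad_sum_jet_terms sum by simp
qed

lemma jet_weight_nth_0:
  "jet_weight k $ 0 = (\<Prod>j<k. ((1 - q ^ (2 * j + 1)) / (1 - q ^ (4 * j + 4)))\<^sup>2)"
  unfolding jet_weight_def
  by (induction k) (simp_all add: power_mult_distrib power_inverse divide_inverse)

text \<open>A logarithmic derivative: the factor \<open>(1 - y)\<^sup>2 - y u\<close> contributes \<open>- y/(1 - y)\<^sup>2\<close>. This is where the two inner sums of
\<^term>\<open>S M\<close> come from.\<close>

lemma jet_weight_nth_1: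
  "jet_weight k $ 1 = - (jet_weight k $ 0) *
     ((\<Sum>j<k. q ^ (2 * j + 1) / (1 - q ^ (2 * j + 1))\<^sup>2) - (\<Sum>j<k. q ^ (4 * j + 4) / (1 - q ^ (4 * j + 4))\<^sup>2))"
proof (induction k)
  case 0
  show ?case by (simp add: jet_weight_def)
next
  case (Suc k)
  define a where "a = q ^ (2 * k + 1)"
  define b where "b = q ^ (4 * k + 4)"
  have nz: "1 - a \<noteq> 0" "1 - b \<noteq> 0" by (simp_all add: a_def b_def del: power_Suc)
  define u where "u = quad_jet a * inverse (quad_jet b)"
  have u: "u $ 0 = (1 - a)\<^sup>2 / (1 - b)\<^sup>2" "u $ 1 = - (u $ 0) * (a / (1 - a)\<^sup>2 - b / (1 - b)\<^sup>2)"
    using nz by (simp_all add: u_def fps_mult_nth_1 fps_inverse_nth_1 field_simps del: One_nat_def)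
       (simp_all add: power2_eq_square power4_eq_xxxx algebra_simps)
  have w: "jet_weight (Suc k) = jet_weight k * u"
    by (simp add: jet_weight_def u_def a_def b_def)
  show ?case
    unfolding w fps_mult_nth_1 Suc u(2) fps_mult_nth_0 sum.lessThan_Suc a_def[symmetric] b_def[symmetric]
    by (simp add: algebra_simps)
qed

lemma S_eq: "S M = - (1 - q) * (\<Sum>k\<le>M. prefactor q k * jet_weight k $ 1)"
proof -
  have "q_int (6 * k + 1)
     * (q_shifted_factorial q (q ^ 2) k ^ 3 * q_shifted_factorial (inverse q) (q ^ 4) k)
     / (q_shifted_factorial (q ^ 4) (q ^ 4) k ^ 3 * q_shifted_factorial (q ^ 4) (q ^ 2) k)
     * q ^ (k ^ 2 + 3 * k)
     * ((\<Sum>i=1..k. q ^ (2 * i - 1) / q_int (2 * i - 1) ^ 2)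
        - (\<Sum>i=1..k. q ^ (4 * i) / q_int (4 * i) ^ 2))
     = - (1 - q) * (prefactor q k * jet_weight k $ 1)" for k
  proof -
    have q1: "1 - q \<noteq> 0" using q_power_eq_1[of 1] by simp
    define s where "s = (\<Sum>j<k. q ^ (2 * j + 1) / (1 - q ^ (2 * j + 1))\<^sup>2) - (\<Sum>j<k. q ^ (4 * j + 4) / (1 - q ^ (4 * j + 4))\<^sup>2)"
    have "(\<Sum>i=1..k. q ^ (2 * i - 1) / q_int (2 * i - 1) ^ 2) = (\<Sum>j<k. (1 - q)\<^sup>2 * (q ^ (2 * j + 1) / (1 - q ^ (2 * j + 1))\<^sup>2))"
      by (rule sum.reindex_bij_witness[of _ Suc "\<lambda>i. i - 1"]) 
         (use q1 in \<open>auto simp: q_int_def power_divide Suc_diff_Suc numeral_2_eq_2 simp del: power_Suc\<close>)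
    moreover have "(\<Sum>i=1..k. q ^ (4 * i) / q_int (4 * i) ^ 2) = (\<Sum>j<k. (1 - q)\<^sup>2 * (q ^ (4 * j + 4) / (1 - q ^ (4 * j + 4))\<^sup>2))"
      by (rule sum.reindex_bij_witness[of _ Suc "\<lambda>i. i - 1"]) 
         (use q1 in \<open>auto simp: q_int_def power_divide algebra_simps simp del: power_Suc\<close>)
    ultimately have sums: "(\<Sum>i=1..k. q ^ (2 * i - 1) / q_int (2 * i - 1) ^ 2)
        - (\<Sum>i=1..k. q ^ (4 * i) / q_int (4 * i) ^ 2) = (1 - q)\<^sup>2 * s"
      by (simp add: s_def right_diff_distrib sum_distrib_left)
    have f1: "q_shifted_factorial q (q ^ 2) k = (\<Prod>j<k. 1 - q ^ (2 * j + 1))"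
      by (simp add: q_shifted_factorial_def power_mult)
    have f2: "q_shifted_factorial (q ^ 4) (q ^ 4) k = (\<Prod>j<k. 1 - q ^ (4 * j + 4))"
      by (simp add: q_shifted_factorial_def algebra_simps flip: power_mult power_add)
    have f3: "q_shifted_factorial (q ^ 4) (q ^ 2) k = (\<Prod>j<k. 1 - q ^ (2 * j + 3) * q)"
      unfolding q_shifted_factorial_def
      by (rule prod.cong) (simp_all add: power_mult power_mult_distrib power_add eval_nat_numeral mult_ac)
    have f4: "q ^ (k ^ 2 + 3 * k) * q_shifted_factorial (inverse q) (q ^ 4) k = (\<Prod>j<k. q ^ (2 * j + 3) * (q - q ^ (4 * j)))"
      by (induction k) (simp_all add: q_shifted_factorial_def power_mult power_add eval_nat_numeral field_simps)
    have pre: "prefactor q k = (1 - q ^ (6 * k + 1)) * ((\<Prod>j<k. q ^ (2 * j + 3) * (q - q ^ (4 * j))) * (\<Prod>j<k. 1 - q ^ (2 * j + 1))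
      / ((\<Prod>j<k. 1 - q ^ (4 * j + 4)) * (\<Prod>j<k. 1 - q ^ (2 * j + 3) * q)))"
      unfolding prefactor_def prod.distrib[symmetric] prod_dividef[symmetric] by (simp add: mult_ac)
    have w: "jet_weight k $ 1 = - ((\<Prod>j<k. 1 - q ^ (2 * j + 1)) / (\<Prod>j<k. 1 - q ^ (4 * j + 4)))\<^sup>2 * s"
      unfolding jet_weight_nth_1 jet_weight_nth_0 s_def by (simp only: prod_power_distrib[symmetric] prod_dividef)
    have alg: "x / c * (P ^ 3 * I) / (W ^ 3 * Y) * t * (c\<^sup>2 * s)
      = - c * (x * (t * I * P / (W * Y)) * (- (P / W)\<^sup>2 * s))" if "c \<noteq> 0" for c x P I W Y t :: ratfun
      using that by (simp add: power2_eq_square power3_eq_cube mult_ac)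
    show ?thesis
      unfolding sums pre w f1 f2 f3 f4[symmetric] q_int_def[of "6 * k + 1"] by (rule alg[OF q1])
  qed
  then show ?thesis
    unfolding S_def by (simp add: sum_distrib_left atMost_atLeast0)
qed

section \<open>Perturbation of the parameters by powers of q to the n\<close>


locale residue_one_mod_four =
  fixes n :: nat
  assumes n_ge: "n \<ge> 5" and n_mod: "n mod 4 = 1"
begin

sublocale R: subring_with_modulus "local_ring n" "1 - q ^ n" by (rule subring_local_ring)

sublocale J: subring_with_modulus "jet_ring n" "fls_const (1 - q ^ n)" by (rule subring_jet_ring)

lemma n_pos: "n > 0" and n_odd: "odd n"
  using n_ge n_mod by (auto simp: even_iff_mod_2_eq_zero) presburger

lemma quarter: "4 * ((3 * n + 1) div 4) = 3 * n + 1"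
  using n_mod by presburger

lemma half: "2 * ((n - 1) div 2) + 1 = n"
  using n_odd n_pos by presburger

lemma not_dvd_4: "0 < i \<Longrightarrow> i < n \<Longrightarrow> \<not> n dvd 4 * i"
proof
  assume i: "0 < i" "i < n" "n dvd 4 * i"
  have "coprime n 4"
    using coprime_power_right_iff[of n 2 2] n_odd by simp
  then have "n dvd i" using i(3) by (simp add: coprime_dvd_mult_right_iff)
  then show False using i by (auto dest: dvd_imp_le)
qed

lemma not_dvd_4_Suc: "j + 1 < n \<Longrightarrow> \<not> n dvd 4 * j + 4"
  using not_dvd_4[of "j + 1"] by (simp add: add.commute)

lemma not_dvd_even: "0 < i \<Longrightarrow> i < 2 * n \<Longrightarrow> even i \<Longrightarrow> \<not> n dvd i"
proof
  assume i: "0 < i" "i < 2 * n" "even i" "n dvd i"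
  have "coprime n 2" using n_odd by simp
  moreover obtain k where "i = 2 * k" using i(3) by blast
  ultimately have "n dvd k" using i(4) by (simp add: coprime_dvd_mult_right_iff)
  then show False using i \<open>i = 2 * k\<close> by (auto dest: dvd_imp_le)
qed

lemma unit_one_minus: "\<not> n dvd i \<Longrightarrow> 1 - q ^ i * (inverse (q ^ n) ^ r * (q ^ n) ^ s) \<in> R.units"
proof -
  assume "\<not> n dvd i"
  then have "(n * r) mod n \<noteq> (i + n * s) mod n" by (simp add: dvd_eq_mod_eq_0)
  then have "q ^ (n * r) - q ^ (i + n * s) \<in> R.units" by (rule unit_q_diff[OF n_pos])
  moreover have "inverse (q ^ (n * r)) \<in> R.units"
    using R.units_power[OF unit_q[OF n_pos], of "n * r"] by (auto simp: R.units_def)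
  ultimately have "inverse (q ^ (n * r)) * (q ^ (n * r) - q ^ (i + n * s)) \<in> R.units"
    by (rule R.units_mult[rotated])
  then show ?thesis
    by (simp add: right_diff_distrib power_add power_mult power_inverse mult_ac)
qed

lemma unit_one_minus_power: "\<not> n dvd i \<Longrightarrow> 1 - q ^ i \<in> R.units"
  using unit_one_minus[of i 0 0] by simp

lemma unit_quad_jet: "1 - y \<in> R.units \<Longrightarrow> fps_to_fls (quad_jet y) \<in> J.units"
proof (rule unit_jet)
  assume y: "1 - y \<in> R.units"
  then show "quad_jet y $ 0 \<in> R.units" by (simp add: R.units_power)
  have "y = 1 - (1 - y)" by simp
  then have "y \<in> local_ring n" using y R.units_closed R.diff_closed R.one_closed by metis
  then show "quad_jet y $ 1 \<in> local_ring n" by simp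
qed

text \<open>The parameters \<open>A = q\<^bsup>1-rn\<^esup>\<close> and \<open>e = q\<^bsup>1+sn\<^esup>\<close>, as constant jets.\<close>

definition base :: "nat \<Rightarrow> ratfun fls" where
  "base r = fls_const (q * inverse (q ^ n) ^ r)"

definition argument :: "nat \<Rightarrow> ratfun fls" where
  "argument s = fls_const (q * (q ^ n) ^ s)"

text \<open>The truncation at \<open>n - 2\<close> is the last one for which all denominators are units: the term with \<open>k = n - 1\<close> contains
\<open>1 - q\<^bsup>2n+(s-r)n\<^esup>\<close> in its denominator.\<close>

definition perturbed_sum :: "nat \<Rightarrow> nat \<Rightarrow> ratfun fls" where
  "perturbed_sum r s = quad_sum (fls_const (q\<^sup>2)) (base r) jet_param (argument s) (n - 2)"

lemma base_power: "base r * fls_const (q\<^sup>2) ^ k = fls_const (q ^ (2 * k + 1) * inverse (q ^ n) ^ r)"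
  unfolding base_def by (simp add: mult_ac flip: fls_const_power power_mult)

lemma base_argument: 
  "base r * fls_const (q\<^sup>2) ^ (j + 1) * argument s = fls_const (q ^ (2 * j + 4) * (inverse (q ^ n) ^ r * (q ^ n) ^ s))"
  unfolding base_power argument_def by (simp add: eval_nat_numeral mult_ac)

lemma quad_den_base: "quad_den (fls_const (q\<^sup>2)) (base r) jet_param j = fps_to_fls (quad_jet (inverse (q ^ n) ^ r * q ^ (4 * j + 4)))"
  unfolding base_def by (rule quad_den_jet)

lemma one_minus_const: "1 - fls_const x = fls_const (1 - x)" for x :: ratfun
  by (simp flip: fls_minus_const)

lemma const_q_square_power: "fls_const (q\<^sup>2) ^ i = fls_const (q ^ (2 * i))"
  by (simp add: power_mult flip: fls_const_power)

text \<open>Every factor of every term is a product of a fixed jet with powers of \<open>q\<^bsup>-rn\<^esup>\<close> and \<open>q\<^bsup>sn\<^esup>\<close>, or a difference of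
such products, and every denominator is a unit.\<close>

lemma perturbed_sum_affine: "J.affine_family perturbed_sum"
proof -
  have q_in: "q \<in> local_ring n" using unit_q[OF n_pos] by (rule R.units_closed)
  have const: "J.affine_family (\<lambda>_ _. fls_const x)" if "x \<in> local_ring n" for x
    using that by (intro J.affine_const const_jet_ring)
  have z: "1 - fls_const (1 - q ^ n) = fls_const (q ^ n)"
    by (simp add: one_minus_const)
  have "fls_const (q ^ n) \<in> J.units"
    by (intro unit_const R.units_power unit_q n_pos)
  then have left: "J.affine_family (\<lambda>r s. fls_const (inverse (q ^ n) ^ r))"
    using J.affine_power_left unfolding z by (simp add: fls_const_power fls_const_inverse)
  have right: "J.affine_family (\<lambda>r s. fls_const ((q ^ n) ^ s))"
    using J.affine_power_right unfolding z by (simp add: fls_const_power)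
  have base: "J.affine_family (\<lambda>r s. base r)"
    unfolding base_def fls_const_mult_const[symmetric] by (intro J.affine_mult left const q_in)
  have arg: "J.affine_family (\<lambda>r s. argument s)"
    unfolding argument_def fls_const_mult_const[symmetric] by (intro J.affine_mult right const q_in)
  have p: "J.affine_family (\<lambda>_ _. fls_const (q\<^sup>2) ^ i)" for i
    unfolding const_q_square_power by (intro const R.power_closed q_in)
  have one: "J.affine_family (\<lambda>_ _. 1)" by (intro J.affine_const) simp
  have param: "J.affine_family (\<lambda>_ _. jet_param)"
  proof (rule J.affine_const)
    have "fls_X = fps_to_fls fps_X" by simp
    moreover have "fps_to_fls fps_X \<in> jet_ring n" by (rule jet_ringI) simp_all
    ultimately show "jet_param \<in> jet_ring n" 
      by (intro J.mult_closed J.add_closed const_jet_ring q_in J.numeral_closed) simp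
  qed
  have num: "J.affine_family (\<lambda>_ _. quad_num (fls_const (q\<^sup>2)) jet_param j)" for j
    unfolding quad_num_def by (intro J.affine_add J.affine_diff J.affine_mult one p param)
  have den: "J.affine_family (\<lambda>r _. quad_den (fls_const (q\<^sup>2)) (base r) jet_param j)" for j
    unfolding quad_den_def power2_eq_square[of "base _"]
    by (intro J.affine_add J.affine_diff J.affine_mult one p param base)
  have units1: "1 - fls_const (q\<^sup>2) ^ (2 * j + 2) \<in> J.units" 
    and units2: "quad_den (fls_const (q\<^sup>2)) (base r) jet_param j \<in> J.units"
    and units3: "1 - base r * fls_const (q\<^sup>2) ^ (j + 1) * argument s \<in> J.units" if "j < n - 2" for j r s
  proof -
    have j: "\<not> n dvd 4 * j + 4" using that by (intro not_dvd_4_Suc) simp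
    show "1 - fls_const (q\<^sup>2) ^ (2 * j + 2) \<in> J.units"
      unfolding const_q_square_power one_minus_const distrib_left using unit_one_minus_power[OF j]
      by (intro unit_const) (simp flip: mult.assoc del: power_Suc)
    show "quad_den (fls_const (q\<^sup>2)) (base r) jet_param j \<in> J.units"
      unfolding quad_den_base using unit_one_minus[OF j, of r 0] 
      by (intro unit_quad_jet) (simp add: mult.commute)
    show "1 - base r * fls_const (q\<^sup>2) ^ (j + 1) * argument s \<in> J.units"
      unfolding base_argument one_minus_const using that
      by (intro unit_const unit_one_minus not_dvd_even) auto
  qed
  show ?thesis
    unfolding perturbed_sum_def[abs_def] quad_sum_def quad_coeff_def
    by (intro J.affine_sum J.affine_prod J.affine_divide J.affine_mult J.affine_diff one base arg p num den
          J.units_mult units1 units2 units3) auto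
qed

lemma quad_den_nonzero: "r \<le> 1 \<Longrightarrow> quad_den (fls_const (q\<^sup>2)) (base r) jet_param j \<noteq> 0"
proof -
  assume r: "r \<le> 1"
  have "4 * j + 4 \<noteq> n * r" using r n_odd by (cases r) auto
  then have "q ^ (4 * j + 4) \<noteq> q ^ (n * r)" by (simp only: q_power_inject not_False_eq_True)
  then have "inverse (q ^ n) ^ r * q ^ (4 * j + 4) \<noteq> 1"
    by (simp add: power_mult field_simps power_inverse del: q_power_inject)
  then have "quad_jet (inverse (q ^ n) ^ r * q ^ (4 * j + 4)) $ 0 \<noteq> 0" by simp
  then have "quad_jet (inverse (q ^ n) ^ r * q ^ (4 * j + 4)) \<noteq> 0" by (metis fps_zero_nth)
  then show ?thesis unfolding quad_den_base by simp
qed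

lemma one_minus_power_nonzero: "1 - fls_const (q\<^sup>2) ^ (2 * j + 2) \<noteq> 0"
proof -
  have "q ^ (2 * (2 * j + 2)) \<noteq> 1" by (simp only: q_power_eq_1) simp
  then show ?thesis
    unfolding const_q_square_power one_minus_const by (metis fls_const_eq_0_iff right_minus_eq)
qed

lemma one_minus_base_argument_nonzero:
  assumes "r \<le> s"
  shows "1 - base r * fls_const (q\<^sup>2) ^ (j + 1) * argument s \<noteq> 0"
proof -
  have "inverse (q ^ n) ^ r * (q ^ n) ^ s = q ^ (n * (s - r))"
    using assms by (simp add: power_mult power_inverse power_diff field_simps)
  then have "q ^ (2 * j + 4) * (inverse (q ^ n) ^ r * (q ^ n) ^ s) = q ^ (2 * j + 4 + n * (s - r))"
    by (simp only: power_add)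
  then show ?thesis unfolding base_argument one_minus_const by (simp del: power_add)
qed

lemma argument_eq: "4 * m = s * n + 1 \<Longrightarrow> argument s = fls_const (q\<^sup>2) ^ (2 * m)"
  unfolding const_q_square_power argument_def
  by (simp add: mult.commute flip: power_mult power_Suc)

lemma one_minus_base_1: "1 - base 1 * fls_const (q\<^sup>2) ^ ((n - 1) div 2) = 0"
  unfolding base_power half by simp

text \<open>Here \<open>A = q\<^bsup>1-n\<^esup>\<close>, so \<open>A p\<^bsup>(n-1)/2\<^esup> = 1\<close>. This truncates the sum, so that the bound \<open>n - 2\<close> can be raised freely, and it
puts a zero factor into the closed form.\<close>

lemma perturbed_sum_vanishes:
  assumes "4 * m = s * n + 1" "s \<ge> 1"
  shows "perturbed_sum 1 s = 0"
proof -
  let ?p = "fls_const (q\<^sup>2)"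
  define K where "K = m + n"
  have zero: "(\<Prod>j<N. 1 - base 1 * ?p ^ j) = 0" if "(n - 1) div 2 < N" for N
    using that one_minus_base_1 by (subst prod_zero_iff) auto
  have "(n - 1) div 2 < 2 * m + 1"
    using assms by (cases s) auto
  then have small: "(\<Prod>j<2 * m + 1. 1 - base 1 * ?p ^ j) = 0" by (rule zero)
  have "quad_sum ?p (base 1) jet_param (?p ^ (2 * m)) K * (\<Prod>j<m. quad_den ?p (base 1) jet_param j) = 0"
    unfolding small[symmetric]
    using one_minus_base_argument_nonzero[OF assms(2)] quad_den_nonzero[of 1] one_minus_power_nonzero
    by (intro quad_sum_closed_form) (auto simp: K_def simp flip: argument_eq[OF assms(1)] simp del: power_Suc One_nat_def)
  moreover have "(\<Prod>j<m. quad_den ?p (base 1) jet_param j) \<noteq> 0"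
    by (subst prod_zero_iff) (auto simp: quad_den_nonzero)
  ultimately have "quad_sum ?p (base 1) jet_param (argument s) K = 0"
    by (simp add: argument_eq[OF assms(1)])
  moreover have "quad_sum ?p (base 1) jet_param (argument s) K = perturbed_sum 1 s"
    unfolding perturbed_sum_def quad_sum_def
  proof (rule sum.mono_neutral_right)
    show "\<forall>k\<in>{..K} - {..n - 2}. (1 - base 1 * ?p ^ (3 * k)) * quad_coeff ?p (base 1) jet_param k *
       (\<Prod>j<k. (argument s - ?p ^ (2 * j)) / (1 - base 1 * ?p ^ (j + 1) * argument s)) = 0"
    proof
      fix k assume "k \<in> {..K} - {..n - 2}"
      then have "(n - 1) div 2 < k" using n_ge by auto
      then have "quad_coeff ?p (base 1) jet_param k = 0"
        unfolding quad_coeff_def using one_minus_base_1 by (subst prod_zero_iff) (auto intro!: bexI[of _ "(n - 1) div 2"])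
      then show "(1 - base 1 * ?p ^ (3 * k)) * quad_coeff ?p (base 1) jet_param k *
       (\<Prod>j<k. (argument s - ?p ^ (2 * j)) / (1 - base 1 * ?p ^ (j + 1) * argument s)) = 0" by simp
    qed
  qed (use n_ge in \<open>auto simp: K_def\<close>)
  ultimately show ?thesis by simp
qed

lemma perturbed_sum_cong: "J.cong_mod ((fls_const (1 - q ^ n))\<^sup>2) (perturbed_sum 0 3) (perturbed_sum 0 0)"
proof (rule J.affine_family_vanishing[OF perturbed_sum_affine])
  show "perturbed_sum 1 3 = 0"
    using perturbed_sum_vanishes[OF quarter] by simp
  have "4 * ((7 * n + 1) div 4) = 7 * n + 1" using n_mod by presburger
  then show "perturbed_sum 1 7 = 0"
    using perturbed_sum_vanishes[of _ 7] by simp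
  show "4 \<in> J.units"
    using unit_const[OF unit_numeral[of "num.Bit0 (num.Bit0 num.One)" n]] by simp
qed

lemma cong_0_of_two_factors:
  assumes "finite I" "i \<in> I" "j \<in> I" "i \<noteq> j" "\<And>k. k \<in> I \<Longrightarrow> f k \<in> local_ring n"
    and "R.cong_mod (1 - q ^ n) (f i) 0" "R.cong_mod (1 - q ^ n) (f j) 0"
  shows "R.cong_mod ((1 - q ^ n)\<^sup>2) (prod f I) 0"
proof -
  obtain a b where ab: "a \<in> local_ring n" "b \<in> local_ring n" "f i = (1 - q ^ n) * a" "f j = (1 - q ^ n) * b"
    using assms(6,7) by (auto simp: R.cong_mod_def)
  have "prod f I = f i * (f j * prod f (I - {i} - {j}))"
    using assms by (simp add: prod.remove[of I i] prod.remove[of "I - {i}" j])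
  also have "\<dots> = (1 - q ^ n)\<^sup>2 * (a * b * prod f (I - {i} - {j}))"
    by (simp add: ab power2_eq_square)
  finally show ?thesis
    unfolding R.cong_mod_def using ab assms(5)
    by (intro bexI[of _ "a * b * prod f (I - {i} - {j})"]) (auto intro!: R.mult_closed R.prod_closed)
qed

lemma one_minus_power_cong: "R.cong_mod (1 - q ^ n) (1 - q ^ (n * k)) 0"
proof -
  have "1 - q ^ (n * k) = (1 - q ^ n) * (\<Sum>i<k. (q ^ n) ^ i)"
    by (simp add: power_mult one_diff_power_eq)
  moreover have "(\<Sum>i<k. (q ^ n) ^ i) \<in> local_ring n"
    using R.units_closed[OF unit_q[OF n_pos]] by (intro R.sum_closed R.power_closed)
  ultimately show ?thesis unfolding R.cong_mod_def by auto
qed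

lemma q_closed [simp]: "q \<in> local_ring n"
  using unit_q[OF n_pos] by (rule R.units_closed)

lemma cong_jet_const: 
  assumes "R.cong_mod ((1 - q ^ n)\<^sup>2) x y"
  shows "J.cong_mod ((fls_const (1 - q ^ n))\<^sup>2) (fls_const x) (fls_const y)"
proof -
  obtain w where "w \<in> local_ring n" "x - y = (1 - q ^ n)\<^sup>2 * w"
    using assms by (auto simp: R.cong_mod_def)
  then have "fls_const x - fls_const y = (fls_const (1 - q ^ n))\<^sup>2 * fls_const w"
    by (simp add: fls_minus_const flip: fls_const_power)
  then show ?thesis unfolding J.cong_mod_def using const_jet_ring \<open>w \<in> local_ring n\<close> by blast
qed

text \<open>With \<open>4 m = 3 n + 1\<close>, the closed form is a unit multiple of \<open>\<Prod>j\<le>2m. 1 - q\<^bsup>2j+1\<^esup>\<close>, whose exponents include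
\<open>n\<close> and \<open>3 n\<close>.\<close>

lemma quad_sum_cong_0:
  assumes "(3 * n + 1) div 4 \<le> K"
  shows "J.cong_mod ((fls_const (1 - q ^ n))\<^sup>2) (quad_sum (fls_const (q\<^sup>2)) (base 0) jet_param (argument 3) K) 0"
proof -
  let ?p = "fls_const (q\<^sup>2)"
  define m where "m = (3 * n + 1) div 4"
  have m: "4 * m = 3 * n + 1" unfolding m_def by (rule quarter)
  define D where "D = (\<Prod>j<m. quad_den ?p (base 0) jet_param j)"
  have D: "D \<in> J.units"
    unfolding D_def
  proof (rule J.units_prod)
    fix j assume "j \<in> {..<m}"
    then have "\<not> n dvd 4 * j + 4" using m n_ge by (intro not_dvd_4_Suc) auto
    then show "quad_den ?p (base 0) jet_param j \<in> J.units"
      unfolding quad_den_base by (intro unit_quad_jet) (simp add: unit_one_minus_power)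
  qed
  have "quad_sum ?p (base 0) jet_param (?p ^ (2 * m)) K * D = (\<Prod>j<2 * m + 1. 1 - base 0 * ?p ^ j)"
    unfolding D_def using one_minus_base_argument_nonzero[of 0 3] quad_den_nonzero[of 0] one_minus_power_nonzero assms[folded m_def]
    by (intro quad_sum_closed_form) (auto simp flip: argument_eq[OF m] simp del: power_Suc)
  also have "\<dots> = fls_const (\<Prod>j<2 * m + 1. 1 - q ^ (2 * j + 1))"
    unfolding fls_const_prod base_power one_minus_const by simp
  finally have eq: "quad_sum ?p (base 0) jet_param (argument 3) K * D = fls_const (\<Prod>j<2 * m + 1. 1 - q ^ (2 * j + 1))"
    by (simp add: argument_eq[OF m])
  have "R.cong_mod ((1 - q ^ n)\<^sup>2) (\<Prod>j<2 * m + 1. 1 - q ^ (2 * j + 1)) 0"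
  proof (rule cong_0_of_two_factors)
    show "(n - 1) div 2 \<in> {..<2 * m + 1}" "(3 * n - 1) div 2 \<in> {..<2 * m + 1}" "(n - 1) div 2 \<noteq> (3 * n - 1) div 2"
      using m n_ge by auto
    show "R.cong_mod (1 - q ^ n) (1 - q ^ (2 * ((n - 1) div 2) + 1)) 0"
      unfolding half using one_minus_power_cong[of 1] by simp
    have "2 * ((3 * n - 1) div 2) + 1 = n * 3" using n_odd by presburger
    then show "R.cong_mod (1 - q ^ n) (1 - q ^ (2 * ((3 * n - 1) div 2) + 1)) 0"
      using one_minus_power_cong[of 3] by simp
  qed simp_all
  then have "J.cong_mod ((fls_const (1 - q ^ n))\<^sup>2) (quad_sum ?p (base 0) jet_param (argument 3) K * D) (0 * D)"
    unfolding eq using cong_jet_const[of _ 0] by simp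
  then show ?thesis using D by (rule J.cong_cancel)
qed

lemma prefactor_sum_shift_cong:
  "R.cong_mod ((1 - q ^ n)\<^sup>2) (\<Sum>k\<le>n - 2. prefactor q k * jet_weight k $ 1)
    (\<Sum>k\<le>n - 2. prefactor (q * (q ^ n) ^ 3) k * jet_weight k $ 1)"
proof -
  have "base 0 = fls_const q" by (simp add: base_def)
  then have "perturbed_sum 0 s $$ 1 = (\<Sum>k\<le>n - 2. prefactor (q * (q ^ n) ^ s) k * jet_weight k $ 1)" for s
    unfolding perturbed_sum_def argument_def by (simp only: quad_sum_jet_nth_1)
  from this[of 0] this[of 3] show ?thesis
    using R.cong_sym[OF cong_jet_nth_1[OF perturbed_sum_cong]] by simp
qed

lemma prefactor_sum_cong_0:
  assumes "(3 * n + 1) div 4 \<le> K"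
  shows "R.cong_mod ((1 - q ^ n)\<^sup>2) (\<Sum>k\<le>K. prefactor (q * (q ^ n) ^ 3) k * jet_weight k $ 1) 0"
proof -
  have "base 0 = fls_const q" by (simp add: base_def)
  then show ?thesis
    using cong_jet_nth_1[OF quad_sum_cong_0[OF assms]] unfolding argument_def by (simp only: quad_sum_jet_nth_1 fls_zero_nth)
qed

section \<open>The boundary term\<close>

text \<open>Congruence modulo \<open>1 - q\<^sup>n\<close> and modulo its square.\<close>

abbreviation cong :: "ratfun \<Rightarrow> ratfun \<Rightarrow> bool" (infix "\<approx>" 50) where
  "x \<approx> y \<equiv> R.cong_mod (1 - q ^ n) x y"

abbreviation cong2 :: "ratfun \<Rightarrow> ratfun \<Rightarrow> bool" (infix "\<approx>\<approx>" 50) where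
  "x \<approx>\<approx> y \<equiv> R.cong_mod ((1 - q ^ n)\<^sup>2) x y"

text \<open>The indices at which the odd exponent \<open>2 j + 1\<close> is \<open>n\<close>, and the exponent \<open>4 j - 1\<close> is \<open>3 n\<close>.\<close>

definition mid :: nat where "mid = (n - 1) div 2"
definition three_quarter :: nat where "three_quarter = (3 * n + 1) div 4"

lemma mid: "2 * mid + 1 = n" unfolding mid_def by (rule half)
lemma three_quarter: "4 * three_quarter = 3 * n + 1" unfolding three_quarter_def by (rule quarter)

lemma q_power_n: "(q ^ n) ^ k \<approx> 1"
proof -
  have "q ^ n - 1 = (1 - q ^ n) * (- 1)" by simp
  then have "q ^ n \<approx> 1" unfolding R.cong_mod_def by (intro bexI[of _ "- 1"]) simp_all
  then have "(q ^ n) ^ k \<approx> 1 ^ k" by (intro R.cong_power) simp_all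
  then show ?thesis by simp
qed

lemma q_power_mod: "q ^ i \<approx> q ^ (i mod n)"
proof -
  have "q ^ i = (q ^ n) ^ (i div n) * q ^ (i mod n)"
    by (simp flip: power_mult power_add)
  also have "\<dots> \<approx> 1 * q ^ (i mod n)"
    by (intro R.cong_mult q_power_n) auto
  finally show ?thesis by simp
qed

lemma q_power_cong: "i mod n = j mod n \<Longrightarrow> q ^ i \<approx> q ^ j"
  using q_power_mod[of i] q_power_mod[of j] by (metis R.cong_sym R.cong_trans)

definition residue_product :: ratfun where
  "residue_product = (\<Prod>i\<in>{1..<n}. 1 - q ^ i)"

lemma residue_product_unit: "residue_product \<in> R.units"
  unfolding residue_product_def by (intro R.units_prod unit_one_minus_power) (auto dest: dvd_imp_le)

lemma progression_inj:
  assumes "coprime n a"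
  shows "inj_on (\<lambda>j. (a * j + b) mod n) {..<n}"
proof (rule inj_onI)
  fix i j assume "i \<in> {..<n}" "j \<in> {..<n}" "(a * i + b) mod n = (a * j + b) mod n"
  then show "i = j"
  proof (induction i j rule: linorder_wlog)
    case (le i j)
    then have "n dvd (a * j + b) - (a * i + b)"
      by (metis add_le_mono1 mod_eq_dvd_iff_nat mult_le_mono2)
    then have "n dvd a * (j - i)" by (simp add: diff_mult_distrib2)
    then have "n dvd j - i" using assms by (simp add: coprime_dvd_mult_right_iff)
    then show ?case using le by (auto dest!: dvd_imp_le)
  qed metis
qed

text \<open>For \<open>a\<close> prime to \<open>n\<close>, the exponents \<open>a j + b\<close> run through all residues modulo \<open>n\<close>, and \<open>i\<close> is the index of the residue \<open>0\<close>.\<close>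

lemma progression_product:
  assumes "coprime n a" "i < n" "n dvd a * i + b"
  shows "(\<Prod>j\<in>{..<n} - {i}. 1 - q ^ (a * j + b)) \<approx> residue_product"
proof -
  let ?g = "\<lambda>j. (a * j + b) mod n"
  have inj: "inj_on ?g {..<n}" by (rule progression_inj[OF assms(1)])
  have "?g ` ({..<n} - {i}) \<subseteq> {1..<n}"
  proof
    fix x assume "x \<in> ?g ` ({..<n} - {i})"
    then obtain j where j: "j < n" "j \<noteq> i" "x = ?g j" by auto
    have "?g j \<noteq> ?g i" using inj_onD[OF inj, of j i] j assms(2) by blast
    then have "x \<noteq> 0" using j assms(3) by (simp add: dvd_eq_mod_eq_0)
    moreover have "x < n" using j n_pos by simp
    ultimately show "x \<in> {1..<n}" by simp
  qed
  moreover have "card (?g ` ({..<n} - {i})) = card {1..<n}"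
    using assms(2) by (subst card_image) (auto intro: inj_on_subset[OF inj])
  ultimately have "?g ` ({..<n} - {i}) = {1..<n}"
    by (intro card_subset_eq) auto
  then have "residue_product = (\<Prod>j\<in>{..<n} - {i}. 1 - q ^ ?g j)"
    unfolding residue_product_def
    by (subst prod.reindex[symmetric, unfolded o_def]) (auto intro: inj_on_subset[OF inj] simp: prod.reindex)
  moreover have "(\<Prod>j\<in>{..<n} - {i}. 1 - q ^ (a * j + b)) \<approx> (\<Prod>j\<in>{..<n} - {i}. 1 - q ^ ?g j)"
    by (intro R.cong_prod R.cong_diff q_power_mod) auto
  ultimately show ?thesis by simp
qed

text \<open>What is left of the products \<open>(q;q\<^sup>2)\<^sub>k\<close>, \<open>(q\<^sup>4;q\<^sup>2)\<^sub>k\<close>, \<open>(q\<^sup>4;q\<^sup>4)\<^sub>k\<close> and \<open>(q\<^sup>-\<^sup>1;q\<^sup>4)\<^sub>k\<close> for \<open>k = n - 1\<close> after the factors divisible by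
\<open>\<Phi>\<^sub>n(q)\<close> are removed. The last one is multiplied by \<open>q\<close> in each factor; for
\<open>n \<noteq> 5\<close> it also absorbs \<open>1 - q\<^bsup>6k+1\<^esup>\<close>, which modulo \<open>\<Phi>\<^sub>n(q)\<close> is the factor with \<open>j = n - 1\<close>.\<close>

definition odd_product :: ratfun where
  "odd_product = (\<Prod>j\<in>{..<n - 1} - {mid}. 1 - q ^ (2 * j + 1))"
definition even_product :: ratfun where
  "even_product = (\<Prod>j<n - 2. 1 - q ^ (2 * j + 4))"
definition quadruple_product :: ratfun where
  "quadruple_product = (\<Prod>j<n - 1. 1 - q ^ (4 * j + 4))"
definition shifted_product :: ratfun where
  "shifted_product = (\<Prod>j\<in>{..<n} - {three_quarter}. q - q ^ (4 * j))"

lemma coprime_n: "coprime n 2" "coprime n 4"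
  using n_odd coprime_power_right_iff[of n 2 2] by simp_all

lemma odd_product: "odd_product * (1 - q ^ (2 * n - 1)) \<approx> residue_product"
proof -
  have set_eq: "{..<n} - {mid} = insert (n - 1) ({..<n - 1} - {mid})" and e: "2 * (n - 1) + 1 = 2 * n - 1"
    using mid n_ge by auto
  have "(\<Prod>j\<in>{..<n} - {mid}. 1 - q ^ (2 * j + 1)) = (1 - q ^ (2 * n - 1)) * odd_product"
    unfolding set_eq odd_product_def e[symmetric] by (rule prod.insert) auto
  then show ?thesis
    using progression_product[OF coprime_n(1), of mid 1] mid n_ge by (simp add: mult.commute)
qed

lemma quadruple_product: "quadruple_product \<approx> residue_product"
proof -
  have "{..<n} - {n - 1} = {..<n - 1}" by auto
  moreover have "4 * (n - 1) + 4 = n * 4" using n_pos by simp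
  then have "n dvd 4 * (n - 1) + 4" by (metis dvd_triv_left)
  ultimately show ?thesis
    using progression_product[OF coprime_n(2), of "n - 1" 4] n_ge
    by (simp only: quadruple_product_def)
qed

lemma even_product: "even_product * (1 - q\<^sup>2) \<approx> residue_product"
proof -
  have "{..<n} - {n - 1} = {..<Suc (n - 2)}" using n_ge by auto
  moreover have "2 * (n - 1) + 2 = n * 2" using n_pos by simp
  then have "n dvd 2 * (n - 1) + 2" by (metis dvd_triv_left)
  moreover have "(\<Prod>j<Suc (n - 2). 1 - q ^ (2 * j + 2)) = (1 - q\<^sup>2) * even_product"
    unfolding even_product_def by (subst prod.lessThan_Suc_shift) (simp add: eval_nat_numeral)
  ultimately show ?thesis
    using progression_product[OF coprime_n(1), of "n - 1" 2] n_ge by (simp add: mult.commute del: prod.lessThan_Suc)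
qed

lemma shifted_product: "shifted_product \<approx> q ^ (n - 1) * residue_product"
proof -
  let ?I = "{..<n} - {three_quarter}"
  have lt: "three_quarter < n" using three_quarter n_ge by auto
  have "4 * three_quarter + (n - 1) = 4 * n" using three_quarter n_ge by auto
  then have prog: "(\<Prod>j\<in>?I. 1 - q ^ (4 * j + (n - 1))) \<approx> residue_product"
    by (intro progression_product coprime_n lt) simp
  have "q - q ^ (4 * j) \<approx> q * (1 - q ^ (4 * j + (n - 1)))" for j
  proof -
    have "q * q ^ (4 * j + (n - 1)) = q ^ (4 * j + n)"
      using n_pos by (simp flip: power_Suc)
    moreover have "q ^ (4 * j) \<approx> q ^ (4 * j + n)" by (rule q_power_cong) simp
    ultimately show ?thesis by (simp add: right_diff_distrib R.cong_diff)
  qed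
  then have "shifted_product \<approx> (\<Prod>j\<in>?I. q * (1 - q ^ (4 * j + (n - 1))))"
    unfolding shifted_product_def by (intro R.cong_prod) auto
  also have "\<dots> = q ^ (n - 1) * (\<Prod>j\<in>?I. 1 - q ^ (4 * j + (n - 1)))"
    using lt by (simp add: prod.distrib)
  also have "\<dots> \<approx> q ^ (n - 1) * residue_product"
    using prog by (intro R.cong_mult_left) auto
  finally show ?thesis .
qed

lemma not_dvd_odd: "j < n \<Longrightarrow> j \<noteq> mid \<Longrightarrow> \<not> n dvd 2 * j + 1"
proof
  assume j: "j < n" "j \<noteq> mid" "n dvd 2 * j + 1"
  then obtain k where k: "2 * j + 1 = n * k" by blast
  then have "n * k < n * 2" using j(1) by linarith
  then have "k < 2" by (simp only: mult_less_cancel1)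
  then have "k = 1" using k by (cases k) auto
  then show False using k j mid by auto
qed

lemma odd_product_unit: "odd_product \<in> R.units"
  unfolding odd_product_def by (intro R.units_prod unit_one_minus_power not_dvd_odd) auto

lemma even_product_unit: "even_product \<in> R.units"
  unfolding even_product_def by (intro R.units_prod unit_one_minus_power not_dvd_even) auto

lemma quadruple_product_unit: "quadruple_product \<in> R.units"
  unfolding quadruple_product_def by (intro R.units_prod unit_one_minus_power not_dvd_4_Suc) auto

lemma one_minus_q_unit: "1 - q \<in> R.units"
  using unit_one_minus_power[of 1] n_ge by simp

text \<open>The term \<open>k = n - 1\<close> of the sum is \<open>(3/2) (1 - q) (1 - q\<^sup>n)\<close> times this quotient, modulo \<open>\<Phi>\<^sub>n(q)\<^sup>2\<close>, when \<open>n \<noteq> 5\<close>.\<close>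

definition boundary_value :: ratfun where
  "boundary_value = q ^ ((n - 1) * (n + 1)) * odd_product ^ 3 * shifted_product / (quadruple_product ^ 3 * even_product)"

text \<open>All four products are powers of \<open>q\<close> times quotients of the product \<open>P\<close> over the nonzero residues by the factor that they
lack, if any, and the four powers of \<open>P\<close> in the numerator cancel those in the denominator.\<close>

lemma boundary_value: "boundary_value \<approx> - (q * (1 + q) / (1 - q)\<^sup>2)"
proof -
  define P where "P = residue_product"
  define u where "u = 1 - q ^ (2 * n - 1)"
  have P: "P \<in> R.units" unfolding P_def by (rule residue_product_unit)
  have nz: "P \<noteq> 0" "1 - q \<noteq> 0" using P one_minus_q_unit by (auto dest: R.units_nonzero)
  have v: "1 - q\<^sup>2 \<in> R.units" using n_ge by (intro unit_one_minus_power) (auto dest: dvd_imp_le)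
  have qu: "q * u = q - q ^ (2 * n)"
    using n_pos by (simp add: u_def right_diff_distrib flip: power_Suc)
  have "q * u \<approx> q - 1"
    unfolding qu using q_power_n[of 2] by (intro R.cong_diff) (simp_all add: power_mult mult.commute flip: power_mult)
  moreover have q1: "q - 1 \<in> R.units"
    using R.units_mult[OF one_minus_q_unit, of "- 1"] by (auto simp: R.units_def)
  ultimately have quu: "q * u \<in> R.units" using unit_of_cong[OF n_pos] by blast
  have "u = q * u * inverse q" by simp
  moreover have "inverse q \<in> R.units" using unit_q[OF n_pos] by (auto simp: R.units_def)
  ultimately have uu: "u \<in> R.units" using quu R.units_mult by metis
  have Pc: "P \<in> local_ring n" using P by (rule R.units_closed)
  have unz: "u \<noteq> 0" using uu by (rule R.units_nonzero)
  have X: "odd_product \<approx> P / u"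
    using R.cong_divide[OF odd_product R.cong_refl _ uu uu] residue_product_unit R.units_closed unz
    by (simp add: P_def u_def)
  have Y: "even_product \<approx> P / (1 - q\<^sup>2)"
    using R.cong_divide[OF even_product R.cong_refl _ v v] residue_product_unit R.units_closed R.units_nonzero[OF v]
    by (simp add: P_def)
  have Pu: "P / u \<in> local_ring n" "P / (1 - q\<^sup>2) \<in> R.units"
    using Pc uu v P by (auto intro: R.divide_closed simp: divide_inverse intro!: R.units_mult) (auto simp: R.units_def)
  have Z: "shifted_product \<approx> q ^ (n - 1) * P" unfolding P_def by (rule shifted_product)
  have Zc: "shifted_product \<in> local_ring n" unfolding shifted_product_def by (intro R.prod_closed) auto
  have W: "quadruple_product \<approx> P" unfolding P_def by (rule quadruple_product)
  note closed = odd_product_unit[THEN R.units_closed] even_product_unit[THEN R.units_closed]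
    quadruple_product_unit[THEN R.units_closed]
  have num: "q ^ ((n - 1) * (n + 1)) * odd_product ^ 3 * shifted_product
      \<approx> q ^ ((n - 1) * (n + 1)) * (P / u) ^ 3 * (q ^ (n - 1) * P)"
    by (intro R.cong_mult R.cong_power R.cong_refl X Z R.mult_closed R.power_closed Pu Pc Zc closed q_closed)
  have den: "quadruple_product ^ 3 * even_product \<approx> P ^ 3 * (P / (1 - q\<^sup>2))"
    by (intro R.cong_mult R.cong_power W Y R.mult_closed R.power_closed Pu R.units_closed[OF Pu(2)] Pc Zc closed)
  have "boundary_value \<approx> (q ^ ((n - 1) * (n + 1)) * (P / u) ^ 3 * (q ^ (n - 1) * P)) / (P ^ 3 * (P / (1 - q\<^sup>2)))"
    unfolding boundary_value_def
    by (intro R.cong_divide num den R.units_mult R.units_power R.mult_closed R.power_closed Pu Pc P q_closed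
        quadruple_product_unit even_product_unit)
  also have "\<dots> = q ^ ((n - 1) * (n + 1)) * q ^ (n - 1) * (1 - q\<^sup>2) / u ^ 3"
    using nz unz by (simp add: field_simps power3_eq_cube)
  also have "\<dots> = (q ^ ((n - 1) * (n + 1)) * q ^ (n - 1) * q\<^sup>2) * (q * (1 - q\<^sup>2)) / (q * u) ^ 3"
    using unz by (simp add: field_simps eval_nat_numeral)
  also have "q ^ ((n - 1) * (n + 1)) * q ^ (n - 1) * q\<^sup>2 = (q ^ n) ^ (n + 1)"
  proof -
    have "(n - 1) * (n + 1) + (n - 1) + 2 = n * (n + 1)"
      using n_pos by (cases n) auto
    then show ?thesis by (metis power_add power_mult)
  qed
  also have "(q ^ n) ^ (n + 1) * (q * (1 - q\<^sup>2)) / (q * u) ^ 3 \<approx> 1 * (q * (1 - q\<^sup>2)) / (q - 1) ^ 3"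
    by (intro R.cong_divide R.cong_mult R.cong_power R.cong_refl q_power_n \<open>q * u \<approx> q - 1\<close> R.units_power quu q1)
       (auto intro: R.units_closed[OF quu])
  also have "1 * (q * (1 - q\<^sup>2)) / (q - 1) ^ 3 = - (q * (1 + q) / (1 - q)\<^sup>2)"
  proof -
    have "q - 1 \<noteq> 0" using nz(2) by simp
    moreover have "(1 - q)\<^sup>2 = (q - 1)\<^sup>2" by (simp add: power2_commute)
    moreover have "1 - q\<^sup>2 = - ((q - 1) * (1 + q))" by (simp add: power2_eq_square algebra_simps)
    ultimately show ?thesis by (simp add: power3_eq_cube power2_eq_square)
  qed
  finally show ?thesis .
qed


text \<open>The quotient \<open>boundary_value\<close> without the contribution of \<^term>\<open>jet_weight (n - 1)\<close>, which is minus the square of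
\<open>odd_product / quadruple_product\<close>.\<close>

definition common_factor :: ratfun where
  "common_factor = q ^ ((n - 1) * (n + 1)) * odd_product * shifted_product / (quadruple_product * even_product)"

lemma common_factor_closed [simp]: "common_factor \<in> local_ring n"
  unfolding common_factor_def shifted_product_def
  by (intro R.divide_closed R.mult_closed R.power_closed R.units_mult R.prod_closed R.diff_closed q_closed
      quadruple_product_unit even_product_unit odd_product_unit[THEN R.units_closed])

lemma prod_odd_powers: "(\<Prod>j<k. q ^ (2 * j + 3)) = q ^ (k * (k + 2))"
  by (induction k) (simp_all add: algebra_simps flip: power_add power_Suc)

text \<open>The constant coefficient of the weight is divisible by \<open>(1 - q\<^sup>n)\<^sup>2\<close>, and exactly one summand of the logarithmic derivative, the
one with \<open>j = (n-1)/2\<close>, has the denominator \<open>(1 - q\<^sup>n)\<^sup>2\<close>.\<close>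

lemma jet_weight_cong:
  assumes "mid < k" "k \<le> n - 1"
  shows "jet_weight k $ 1 \<approx> - ((\<Prod>j\<in>{..<k} - {mid}. 1 - q ^ (2 * j + 1)) / (\<Prod>j<k. 1 - q ^ (4 * j + 4)))\<^sup>2"
    and "jet_weight k $ 1 \<in> local_ring n"
proof -
  define V where "V = ((\<Prod>j\<in>{..<k} - {mid}. 1 - q ^ (2 * j + 1)) / (\<Prod>j<k. 1 - q ^ (4 * j + 4)))\<^sup>2"
  define t where "t = (\<Sum>j\<in>{..<k} - {mid}. q ^ (2 * j + 1) / (1 - q ^ (2 * j + 1))\<^sup>2) - (\<Sum>j<k. q ^ (4 * j + 4) / (1 - q ^ (4 * j + 4))\<^sup>2)"
  have den: "1 - q ^ (4 * j + 4) \<in> R.units" if "j < k" for j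
    using that assms by (intro unit_one_minus_power not_dvd_4_Suc) auto
  have odd: "1 - q ^ (2 * j + 1) \<in> R.units" if "j \<in> {..<k} - {mid}" for j
    using that assms by (intro unit_one_minus_power not_dvd_odd) auto
  have V: "V \<in> local_ring n"
    unfolding V_def by (intro R.power_closed R.divide_closed R.units_prod R.units_closed[OF R.units_prod] den odd) auto
  have t: "t \<in> local_ring n"
    unfolding t_def by (intro R.diff_closed R.sum_closed R.divide_closed R.units_power den odd R.power_closed q_closed) auto
  have nz: "1 - q ^ n \<noteq> 0" using n_pos by simp
  have mem: "mid \<in> {..<k}" using assms by simp
  have "(\<Prod>j<k. 1 - q ^ (2 * j + 1)) = (1 - q ^ n) * (\<Prod>j\<in>{..<k} - {mid}. 1 - q ^ (2 * j + 1))"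
    by (subst prod.remove[OF _ mem]) (simp_all only: mid finite_lessThan)
  then have w0: "jet_weight k $ 0 = (1 - q ^ n)\<^sup>2 * V"
    unfolding jet_weight_nth_0 V_def by (simp add: prod_dividef power_mult_distrib power_divide flip: prod_power_distrib del: power_Suc)
  have "(\<Sum>j<k. q ^ (2 * j + 1) / (1 - q ^ (2 * j + 1))\<^sup>2)
      = q ^ n / (1 - q ^ n)\<^sup>2 + (\<Sum>j\<in>{..<k} - {mid}. q ^ (2 * j + 1) / (1 - q ^ (2 * j + 1))\<^sup>2)"
    by (subst sum.remove[OF _ mem]) (simp_all only: mid finite_lessThan)
  then have "jet_weight k $ 1 = - ((1 - q ^ n)\<^sup>2 * V) * (q ^ n / (1 - q ^ n)\<^sup>2 + t)"
    unfolding jet_weight_nth_1 w0 t_def by simp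
  also have "\<dots> = - V + (1 - q ^ n) * (V - (1 - q ^ n) * (V * t))"
  proof -
    have "- (c\<^sup>2 * V) * (x / c\<^sup>2 + t) = - V + c * (V - c * (V * t))" if "c \<noteq> 0" "x = 1 - c" for c x
    proof -
      have "- (c\<^sup>2 * V) * (x / c\<^sup>2 + t) = - (V * x) - c\<^sup>2 * (V * t)"
        using that(1) by (simp add: distrib_left)
      then show ?thesis unfolding that(2) by (simp add: algebra_simps power2_eq_square)
    qed
    from this[OF nz] show ?thesis by simp
  qed
  finally have w: "jet_weight k $ 1 = - V + (1 - q ^ n) * (V - (1 - q ^ n) * (V * t))" .
  then show "jet_weight k $ 1 \<approx> - V"
    unfolding R.cong_mod_def using V t
    by (intro bexI[of _ "V - (1 - q ^ n) * (V * t)"]) simp_all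
  show "jet_weight k $ 1 \<in> local_ring n"
    unfolding w using V t by simp
qed

text \<open>The factors \<open>1 - q\<^sup>n\<close> and \<open>q - q\<^bsup>3n+1\<^esup>\<close> both occur in the prefactor, and the coefficient of the weight has no
\<open>\<Phi>\<^sub>n(q)\<close> in its denominator.\<close>

lemma term_beyond_three_quarter_cong_0:
  assumes "three_quarter < k" "k \<le> n - 2"
  shows "prefactor q k * jet_weight k $ 1 \<approx>\<approx> 0"
proof -
  let ?f = "\<lambda>j. q ^ (2 * j + 3) * (1 - q ^ (2 * j + 1)) * (q - q ^ (4 * j)) / ((1 - q ^ (4 * j + 4)) * (1 - q ^ (2 * j + 3) * q))"
  have lt: "mid < three_quarter" using mid three_quarter n_ge by linarith
  have den: "(1 - q ^ (4 * j + 4)) * (1 - q ^ (2 * j + 3) * q) \<in> R.units" if "j < k" for j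
  proof -
    have "1 - q ^ (2 * j + 3) * q = 1 - q ^ (2 * j + 4)" by (simp add: eval_nat_numeral mult_ac)
    moreover have "1 - q ^ (2 * j + 4) \<in> R.units"
      using that assms by (intro unit_one_minus_power not_dvd_even) auto
    moreover have "1 - q ^ (4 * j + 4) \<in> R.units"
      using that assms by (intro unit_one_minus_power not_dvd_4_Suc) auto
    ultimately show ?thesis by (metis R.units_mult)
  qed
  have zero: "x / y \<approx> 0" if "x \<approx> 0" "y \<in> R.units" for x y
    using R.cong_divide[OF that(1) R.cong_refl _ that(2) that(2)] by simp
  have "prod ?f {..<k} \<approx>\<approx> 0"
  proof (rule cong_0_of_two_factors)
    show "mid \<in> {..<k}" "three_quarter \<in> {..<k}" "mid \<noteq> three_quarter" using lt assms by auto
    show "?f j \<in> local_ring n" if "j \<in> {..<k}" for j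
      using that by (intro R.divide_closed den) auto
    have "1 - q ^ (2 * mid + 1) \<approx> 0" unfolding mid using one_minus_power_cong[of 1] by simp
    then have "q ^ (2 * mid + 3) * (q - q ^ (4 * mid)) * (1 - q ^ (2 * mid + 1)) \<approx> q ^ (2 * mid + 3) * (q - q ^ (4 * mid)) * 0"
      by (intro R.cong_mult_left) auto
    then show "?f mid \<approx> 0" using lt assms by (intro zero den) (simp_all only: mult_ac mult_zero_left mult_zero_right)
    have "q - q ^ (4 * three_quarter) = q * (1 - q ^ (n * 3))"
      unfolding three_quarter by (simp add: right_diff_distrib mult.commute)
    moreover have "q * (1 - q ^ (n * 3)) \<approx> q * 0"
      by (intro R.cong_mult_left one_minus_power_cong) simp
    ultimately have "q - q ^ (4 * three_quarter) \<approx> 0" by simp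
    then have "q ^ (2 * three_quarter + 3) * (1 - q ^ (2 * three_quarter + 1)) * (q - q ^ (4 * three_quarter))
        \<approx> q ^ (2 * three_quarter + 3) * (1 - q ^ (2 * three_quarter + 1)) * 0"
      by (intro R.cong_mult_left) auto
    then show "?f three_quarter \<approx> 0" using assms by (intro zero den) simp_all
  qed simp
  then have "(1 - q ^ (6 * k + 1)) * jet_weight k $ 1 * prod ?f {..<k} \<approx>\<approx> (1 - q ^ (6 * k + 1)) * jet_weight k $ 1 * 0"
    using jet_weight_cong(2)[of k] lt assms by (intro R.cong_mult_left R.mult_closed) auto
  then show ?thesis
    unfolding prefactor_def by (simp add: mult_ac)
qed

lemma geometric_cong: "(\<Sum>i<k. (q ^ n) ^ i) \<approx> of_nat k"
proof -
  have "(\<Sum>i<k. (q ^ n) ^ i) \<approx> (\<Sum>i<k. 1)" by (intro R.cong_sum q_power_n)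
  then show ?thesis by simp
qed

lemma ratio_cong:
  assumes "of_nat b \<in> R.units"
  shows "(1 - q ^ (n * a)) / (1 - q ^ (n * b)) \<approx> of_nat a / of_nat b"
proof -
  define g where "g k = (\<Sum>i<k. (q ^ n) ^ i)" for k
  have g: "1 - q ^ (n * k) = (1 - q ^ n) * g k" for k
    unfolding g_def by (simp add: power_mult one_diff_power_eq)
  have "1 - q ^ n \<noteq> 0" using n_pos by simp
  then have "(1 - q ^ (n * a)) / (1 - q ^ (n * b)) = g a / g b" unfolding g by simp
  moreover have "g a / g b \<approx> of_nat a / of_nat b"
    unfolding g_def using unit_of_cong[OF n_pos assms geometric_cong]
    by (intro R.cong_divide geometric_cong assms) auto
  ultimately show ?thesis by simp
qed

lemma last_prefactor:
  "prefactor (q * (q ^ n) ^ s) (n - 1) = (1 - q ^ n) * ((1 - q ^ (6 * (n - 1) + 1)) / (1 - q ^ (n * (s + 2))) *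
     (q ^ ((n - 1) * (n + 1)) * odd_product * (\<Prod>j<n - 1. q * (q ^ n) ^ s - q ^ (4 * j))
       / (quadruple_product * (\<Prod>j<n - 2. 1 - q ^ (2 * j + 4) * (q ^ n) ^ s))))"
proof -
  have "mid \<in> {..<n - 1}" using mid n_ge by auto
  then have odd: "(\<Prod>j<n - 1. 1 - q ^ (2 * j + 1)) = (1 - q ^ n) * odd_product"
    unfolding odd_product_def by (subst prod.remove[of _ mid]) (simp_all only: mid finite_lessThan)
  have even: "(\<Prod>j<n - 1. 1 - q ^ (2 * j + 3) * (q * (q ^ n) ^ s))
      = (\<Prod>j<n - 2. 1 - q ^ (2 * j + 4) * (q ^ n) ^ s) * (1 - q ^ (n * (s + 2)))"
  proof -
    have "(\<Prod>j<n - 1. 1 - q ^ (2 * j + 3) * (q * (q ^ n) ^ s)) = (\<Prod>j<Suc (n - 2). 1 - q ^ (2 * j + 4) * (q ^ n) ^ s)"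
      using n_ge by (intro prod.cong) (auto simp: eval_nat_numeral mult_ac Suc_diff_Suc)
    moreover have "q ^ (2 * (n - 2) + 4) * (q ^ n) ^ s = q ^ (n * (s + 2))"
    proof -
      have "2 * (n - 2) + 4 + n * s = n * (s + 2)" using n_ge by (simp add: algebra_simps)
      then show ?thesis by (metis power_add power_mult)
    qed
    ultimately show ?thesis by simp
  qed
  have power: "(\<Prod>j<n - 1. q ^ (2 * j + 3)) = q ^ ((n - 1) * (n + 1))"
    using prod_odd_powers[of "n - 1"] n_ge by simp
  have "a * (g * (d * x) * z / (w * (y * e))) = d * (a / e * (g * x * z / (w * y)))" for a g d x z w y e :: ratfun
    by (simp add: mult_ac)
  then show ?thesis
    unfolding prefactor_def prod_dividef prod.distrib quadruple_product_def[symmetric] odd even power .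
qed

text \<open>For \<open>n = 5\<close> the exponent \<open>6 k + 1 = 25\<close> at \<open>k = n - 1\<close> is the multiple \<open>5 n\<close>, whereas no \<open>4 j - 1\<close> with \<open>j < k\<close> is a multiple of \<open>n\<close>. The
quotient \<open>(1 - q\<^bsup>5n\<^esup>)/(1 - q\<^bsup>(s+2)n\<^esup>)\<close> gives the constant.\<close>

lemma last_prefactor_five:
  assumes "n = 5" "of_nat (s + 2) \<in> R.units"
  shows "prefactor (q * (q ^ n) ^ s) (n - 1) \<approx>\<approx> (1 - q ^ n) * (5 / of_nat (s + 2) * common_factor)"
proof -
  have tq: "three_quarter = n - 1" using three_quarter assms(1) by simp
  have "q * (q ^ n) ^ s - q ^ (4 * j) \<approx> q - q ^ (4 * j)" for j
    using R.cong_mult_left[OF q_closed q_power_n[of s]] by (intro R.cong_diff) simp_all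
  then have "(\<Prod>j<n - 1. q * (q ^ n) ^ s - q ^ (4 * j)) \<approx> (\<Prod>j<n - 1. q - q ^ (4 * j))"
    by (intro R.cong_prod) auto
  moreover have "{..<n - 1} = {..<n} - {three_quarter}" unfolding tq using n_ge by auto
  ultimately have Z: "(\<Prod>j<n - 1. q * (q ^ n) ^ s - q ^ (4 * j)) \<approx> shifted_product"
    unfolding shifted_product_def by simp
  have "1 - q ^ (2 * j + 4) * (q ^ n) ^ s \<approx> 1 - q ^ (2 * j + 4)" for j
    using R.cong_mult_left[OF _ q_power_n[of s], of "q ^ (2 * j + 4)"] by (intro R.cong_diff) simp_all
  then have Y: "(\<Prod>j<n - 2. 1 - q ^ (2 * j + 4) * (q ^ n) ^ s) \<approx> even_product"
    unfolding even_product_def by (intro R.cong_prod) auto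
  have Yu: "(\<Prod>j<n - 2. 1 - q ^ (2 * j + 4) * (q ^ n) ^ s) \<in> R.units"
    by (rule unit_of_cong[OF n_pos even_product_unit Y])
  have e: "6 * (n - 1) + 1 = n * 5" using assms(1) by simp
  have Zc: "shifted_product \<in> local_ring n" "(\<Prod>j<n - 1. q * (q ^ n) ^ s - q ^ (4 * j)) \<in> local_ring n"
    unfolding shifted_product_def by (intro R.prod_closed; simp)+
  have "(1 - q ^ (6 * (n - 1) + 1)) / (1 - q ^ (n * (s + 2))) *
     (q ^ ((n - 1) * (n + 1)) * odd_product * (\<Prod>j<n - 1. q * (q ^ n) ^ s - q ^ (4 * j))
       / (quadruple_product * (\<Prod>j<n - 2. 1 - q ^ (2 * j + 4) * (q ^ n) ^ s)))
     \<approx> of_nat 5 / of_nat (s + 2) * common_factor"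
    unfolding e common_factor_def
    by (intro R.cong_mult ratio_cong assms R.cong_divide R.cong_refl Z Y R.mult_closed R.divide_closed R.power_closed
        R.units_mult quadruple_product_unit even_product_unit Yu Zc odd_product_unit[THEN R.units_closed] q_closed R.of_nat_closed
        quadruple_product_unit[THEN R.units_closed] Yu[THEN R.units_closed])
  then show ?thesis
    unfolding last_prefactor using R.cong_scale[of "1 - q ^ n" _ _ "1 - q ^ n"] by (simp only: power2_eq_square of_nat_numeral)
qed

text \<open>For \<open>n \<noteq> 5\<close> the index \<open>(3n+1)/4\<close> is smaller than \<open>n - 1\<close>, and the constant comes from
\<open>(1 - q\<^bsup>3n\<^esup>)/(1 - q\<^bsup>2n\<^esup>)\<close>.\<close>

lemma last_prefactor_not_five:
  assumes "n \<noteq> 5"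
  shows "prefactor q (n - 1) \<approx>\<approx> (1 - q ^ n) * (3 / 2 * common_factor)"
proof -
  have lt: "three_quarter < n - 1" using three_quarter n_ge n_mod assms by presburger
  let ?rest = "\<Prod>j\<in>{..<n - 1} - {three_quarter}. q - q ^ (4 * j)"
  have rest: "(\<Prod>j<n - 1. q - q ^ (4 * j)) = q * (1 - q ^ (n * 3)) * ?rest"
    using lt by (subst prod.remove[of _ three_quarter])
      (simp_all add: three_quarter right_diff_distrib mult.commute[of n])
  have "{..<n} - {three_quarter} = insert (n - 1) ({..<n - 1} - {three_quarter})" using lt by auto
  then have Z: "shifted_product = (q - q ^ (4 * (n - 1))) * ?rest"
    unfolding shifted_product_def by simp
  have num: "(1 - q ^ (6 * (n - 1) + 1)) * q \<approx> q - q ^ (4 * (n - 1))"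
  proof -
    have "(1 - q ^ (6 * (n - 1) + 1)) * q = q - q ^ (6 * (n - 1) + 2)" by (simp add: algebra_simps)
    moreover have "6 * (n - 1) + 2 = 4 * (n - 1) + n * 2" using n_ge by simp
    then have "(6 * (n - 1) + 2) mod n = 4 * (n - 1) mod n" by (simp only: mod_mult_self2)
    then have "q ^ (6 * (n - 1) + 2) \<approx> q ^ (4 * (n - 1))" by (rule q_power_cong)
    ultimately show ?thesis by (simp only: R.cong_diff R.cong_refl)
  qed
  have unit2: "of_nat 2 \<in> R.units" using unit_numeral[of "num.Bit0 num.One" n] by simp
  have restc: "?rest \<in> local_ring n" by (intro R.prod_closed) simp
  have closed: "odd_product \<in> local_ring n" using odd_product_unit by (rule R.units_closed)
  have half_closed: "of_nat 3 / of_nat 2 \<in> local_ring n" by (intro R.divide_closed unit2) simp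
  define Q where "Q = q ^ ((n - 1) * (n + 1)) * odd_product * ?rest / (quadruple_product * even_product)"
  have Q: "Q \<in> local_ring n"
    unfolding Q_def by (intro R.divide_closed R.mult_closed R.power_closed R.units_mult quadruple_product_unit even_product_unit restc closed q_closed)
  have "prefactor q (n - 1) = (1 - q ^ n) * ((1 - q ^ (6 * (n - 1) + 1)) / (1 - q ^ (n * 2)) *
     (q ^ ((n - 1) * (n + 1)) * odd_product * (q * (1 - q ^ (n * 3)) * ?rest) / (quadruple_product * even_product)))"
    using last_prefactor[of 0] unfolding even_product_def rest[symmetric] by (simp only: power_0 mult_1_right add_0)
  then have "prefactor q (n - 1) = (1 - q ^ n) * ((1 - q ^ (n * 3)) / (1 - q ^ (n * 2)) * (((1 - q ^ (6 * (n - 1) + 1)) * q) * Q))"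
    unfolding Q_def by (simp only: times_divide_eq_left times_divide_eq_right divide_divide_eq_left mult_ac)
  moreover have "(1 - q ^ (n * 3)) / (1 - q ^ (n * 2)) * (((1 - q ^ (6 * (n - 1) + 1)) * q) * Q)
      \<approx> of_nat 3 / of_nat 2 * ((q - q ^ (4 * (n - 1))) * Q)"
    by (intro R.cong_mult ratio_cong unit2 num R.cong_refl R.mult_closed Q half_closed) simp_all
  moreover have "(q - q ^ (4 * (n - 1))) * Q = common_factor"
    unfolding Q_def common_factor_def Z by simp
  ultimately show ?thesis
    using R.cong_scale[of "1 - q ^ n" _ _ "1 - q ^ n"] by (simp only: power2_eq_square of_nat_numeral)
qed

text \<open>If \<open>n \<noteq> 5\<close>, the sum up to \<open>n - 2\<close> vanishes and \<open>C\<close> is the prefactor of the last term. If \<open>n = 5\<close>, the closed form needs the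
term \<open>k = n - 1\<close> of the series perturbed by \<open>s = 3\<close>, so the sum up to \<open>n - 2\<close> is minus that term, and \<open>C\<close> is the difference of the
prefactors for \<open>s = 0\<close> and \<open>s = 3\<close>.\<close>

lemma sum_up_to_last:
  "\<exists>C. C \<approx>\<approx> (1 - q ^ n) * (3 / 2 * common_factor) \<and>
     (\<Sum>k\<le>n - 1. prefactor q k * jet_weight k $ 1) \<approx>\<approx> C * jet_weight (n - 1) $ 1"
proof -
  have split: "(\<Sum>k\<le>n - 1. f k) = (\<Sum>k\<le>n - 2. f k) + f (n - 1)" for f :: "nat \<Rightarrow> ratfun"
    using n_ge sum.atMost_Suc[of f "n - 2"] by (simp add: Suc_diff_Suc numeral_2_eq_2)
  let ?t = "\<lambda>k. prefactor (q * (q ^ n) ^ 3) k * jet_weight k $ 1"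
  show ?thesis
  proof (cases "n = 5")
    case False
    then have "three_quarter \<le> n - 2" using three_quarter n_ge n_mod by presburger
    then have "(\<Sum>k\<le>n - 2. ?t k) \<approx>\<approx> 0"
      unfolding three_quarter_def by (rule prefactor_sum_cong_0)
    then have "(\<Sum>k\<le>n - 2. prefactor q k * jet_weight k $ 1) \<approx>\<approx> 0"
      using prefactor_sum_shift_cong R.cong_trans by blast
    then have "(\<Sum>k\<le>n - 1. prefactor q k * jet_weight k $ 1) \<approx>\<approx> 0 + prefactor q (n - 1) * jet_weight (n - 1) $ 1"
      unfolding split by (intro R.cong_add R.cong_refl)
    then show ?thesis
      using last_prefactor_not_five[OF False] by (intro exI[of _ "prefactor q (n - 1)"]) simp
  next
    case True
    have "three_quarter \<le> n - 1" using three_quarter True by simp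
    then have "(\<Sum>k\<le>n - 1. ?t k) \<approx>\<approx> 0"
      unfolding three_quarter_def by (rule prefactor_sum_cong_0)
    then have "(\<Sum>k\<le>n - 1. ?t k) - ?t (n - 1) \<approx>\<approx> 0 - ?t (n - 1)"
      by (intro R.cong_diff R.cong_refl)
    then have "(\<Sum>k\<le>n - 2. ?t k) \<approx>\<approx> - ?t (n - 1)" unfolding split by simp
    then have "(\<Sum>k\<le>n - 2. prefactor q k * jet_weight k $ 1) \<approx>\<approx> - ?t (n - 1)"
      using prefactor_sum_shift_cong R.cong_trans by blast
    then have "(\<Sum>k\<le>n - 1. prefactor q k * jet_weight k $ 1) \<approx>\<approx> - ?t (n - 1) + prefactor q (n - 1) * jet_weight (n - 1) $ 1"
      unfolding split by (intro R.cong_add R.cong_refl)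
    then have sum: "(\<Sum>k\<le>n - 1. prefactor q k * jet_weight k $ 1) \<approx>\<approx>
        (prefactor q (n - 1) - prefactor (q * (q ^ n) ^ 3) (n - 1)) * jet_weight (n - 1) $ 1"
      by (simp add: left_diff_distrib)
    have "of_nat (0 + 2) \<in> R.units" "of_nat (3 + 2) \<in> R.units"
      using unit_numeral[of "num.Bit0 num.One" n] unit_numeral[of "num.Bit1 (num.Bit0 num.One)" n] by simp_all
    from R.cong_diff[OF last_prefactor_five[OF True this(1)] last_prefactor_five[OF True this(2)]]
    have "prefactor q (n - 1) - prefactor (q * (q ^ n) ^ 3) (n - 1)
        \<approx>\<approx> (1 - q ^ n) * (5 / 2 * common_factor) - (1 - q ^ n) * (5 / 5 * common_factor)"
      by (simp del: divide_self_if)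
    also have "\<dots> = (1 - q ^ n) * (3 / 2 * common_factor)"
      by (simp add: field_simps)
    finally show ?thesis using sum by blast
  qed
qed

lemma S_last: "S (n - 1) \<approx>\<approx> - (3 * q * (1 + q) * q_int n / 2)"
proof -
  let ?w = "jet_weight (n - 1) $ 1"
  obtain C where C: "C \<approx>\<approx> (1 - q ^ n) * (3 / 2 * common_factor)"
    "(\<Sum>k\<le>n - 1. prefactor q k * jet_weight k $ 1) \<approx>\<approx> C * ?w"
    using sum_up_to_last by blast
  have lt: "mid < n - 1" using mid n_ge by auto
  define V where "V = (odd_product / quadruple_product)\<^sup>2"
  have w: "?w \<approx> - V" "?w \<in> local_ring n"
    using jet_weight_cong[OF lt] unfolding V_def odd_product_def quadruple_product_def by simp_all
  have q1: "1 - q \<noteq> 0" using one_minus_q_unit by (rule R.units_nonzero)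
  have three_half: "3 / 2 \<in> local_ring n"
    using R.divide_closed[OF R.numeral_closed unit_numeral] .
  have "C * ?w \<approx>\<approx> (1 - q ^ n) * (3 / 2 * common_factor) * ?w"
    using R.cong_mult_left[OF w(2) C(1)] by (simp add: mult.commute)
  also have "(1 - q ^ n) * (3 / 2 * common_factor) * ?w = (1 - q ^ n) * (3 / 2 * common_factor * ?w)"
    by simp
  also have "\<dots> \<approx>\<approx> (1 - q ^ n) * (3 / 2 * common_factor * - V)"
    unfolding power2_eq_square using three_half
    by (intro R.cong_scale R.cong_mult_left w R.mult_closed) simp_all
  also have "\<dots> = (1 - q ^ n) * (- (3 / 2) * boundary_value)"
    unfolding V_def common_factor_def boundary_value_def by (simp add: power_divide power2_eq_square power3_eq_cube mult_ac)
  also have "\<dots> \<approx>\<approx> (1 - q ^ n) * (- (3 / 2) * - (q * (1 + q) / (1 - q)\<^sup>2))"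
    unfolding power2_eq_square[of "1 - q ^ n"] using three_half
    by (intro R.cong_scale R.cong_mult_left boundary_value R.uminus_closed)
  finally have "(\<Sum>k\<le>n - 1. prefactor q k * jet_weight k $ 1) \<approx>\<approx> (1 - q ^ n) * (- (3 / 2) * - (q * (1 + q) / (1 - q)\<^sup>2))"
    using C(2) R.cong_trans by blast
  then have "S (n - 1) \<approx>\<approx> - (1 - q) * ((1 - q ^ n) * (- (3 / 2) * - (q * (1 + q) / (1 - q)\<^sup>2)))"
    unfolding S_eq by (intro R.cong_mult_left) auto
  also have "- (1 - q) * ((1 - q ^ n) * (- (3 / 2) * - (q * (1 + q) / (1 - q)\<^sup>2))) = - (3 * q * (1 + q) * q_int n / 2)"
  proof -
    have "- c * (D * (- (3 / 2) * - (x / c\<^sup>2))) = - (3 * x * (D / c) / 2)" if "c \<noteq> 0" for c D x :: ratfun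
      using that by (simp add: field_simps power2_eq_square)
    from this[OF q1, of "1 - q ^ n" "q * (1 + q)"] show ?thesis
      by (simp add: q_int_def mult.assoc)
  qed
  finally show ?thesis .
qed

lemma S_three_quarter:
  assumes "n > 5"
  shows "S three_quarter \<approx>\<approx> 0"
proof -
  let ?f = "\<lambda>k. prefactor q k * jet_weight k $ 1"
  have le: "three_quarter \<le> n - 2" using three_quarter assms n_mod by presburger
  then have "(\<Sum>k\<le>n - 2. prefactor (q * (q ^ n) ^ 3) k * jet_weight k $ 1) \<approx>\<approx> 0"
    unfolding three_quarter_def by (rule prefactor_sum_cong_0)
  then have "(\<Sum>k\<le>n - 2. ?f k) \<approx>\<approx> 0" using prefactor_sum_shift_cong R.cong_trans by blast
  moreover have "(\<Sum>k\<in>{three_quarter<..n - 2}. ?f k) \<approx>\<approx> (\<Sum>k\<in>{three_quarter<..n - 2}. 0)"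
    by (intro R.cong_sum term_beyond_three_quarter_cong_0) auto
  ultimately have "(\<Sum>k\<le>n - 2. ?f k) - (\<Sum>k\<in>{three_quarter<..n - 2}. ?f k) \<approx>\<approx> 0 - (\<Sum>k\<in>{three_quarter<..n - 2}. 0)"
    by (rule R.cong_diff)
  moreover have "(\<Sum>k\<le>n - 2. ?f k) = (\<Sum>k\<le>three_quarter. ?f k) + (\<Sum>k\<in>{three_quarter<..n - 2}. ?f k)"
    using le by (subst sum.union_disjoint[symmetric]) (auto intro!: sum.cong)
  ultimately have "(\<Sum>k\<le>three_quarter. ?f k) \<approx>\<approx> 0" by simp
  then have "- (1 - q) * (\<Sum>k\<le>three_quarter. ?f k) \<approx>\<approx> - (1 - q) * 0"
    by (intro R.cong_mult_left) auto
  then show ?thesis unfolding S_eq by simp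
qed

end

theorem theorem1:
  fixes n :: nat
  assumes "odd n" and "n > 0" and "n mod 4 = 1"
  shows "(n > 5 \<longrightarrow> ratfun_cong (S ((3 * n + 1) div 4)) 0 (cyclotomic n ^ 2)) \<and>
         (n \<ge> 5 \<longrightarrow> ratfun_cong (S (n - 1)) (- (3 * q * (1 + q) * q_int n / 2)) (cyclotomic n ^ 2))"
proof (intro conjI impI)
  assume n: "n > 5"
  then interpret residue_one_mod_four n
    using assms by unfold_locales auto
  show "ratfun_cong (S ((3 * n + 1) div 4)) 0 (cyclotomic n ^ 2)"
    using S_three_quarter[OF n] assms(2) unfolding three_quarter_def by (intro ratfun_congI)
next
  assume "n \<ge> 5"
  then interpret residue_one_mod_four n
    using assms by unfold_locales auto
  show "ratfun_cong (S (n - 1)) (- (3 * q * (1 + q) * q_int n / 2)) (cyclotomic n ^ 2)"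
    using S_last assms(2) by (intro ratfun_congI)
qed

end
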